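(* Let $k\geq t+2\geq 4$ and $n\geq t+(k-t)\cdot\max\{18(t+2),\,2ek\}$. If $\mathcal{F}\subseteq\binom{[n]}{k}$ is $t$-intersecting, then $$\gamma_t(\mathcal{F})\leq\gamma_t(\mathcal{A}(n,k,t)).$$ If equality holds, then $\mathcal{F}\subseteq\mathcal{A}(Z)$ for some $Z\in\binom{[n]}{t+2}$.
   Context: $n,k,t$ are positive integers, $[n]=\{1,\dots,n\}$, $\binom{[n]}{k}$ is the family of all $k$-subsets of $[n]$, and $e$ is the base of the natural logarithm. A family $\mathcal{F}$ is $t$-intersecting if $|F\cap F'|\ge t$ for all $F,F'\in\mathcal{F}$. For a family $\mathcal{F}$ of subsets of $[n]$, $\Delta_t(\mathcal{F})=\max\{|\{F\in\mathcal{F}:S\subseteq F\}|:S\in\binom{[n]}{t}\}$ and the $t$-diversity is $\gamma_t(\mathcal{F}):=|\mathcal{F}|-\Delta_t(\mathcal{F})$. For $Z\in\binom{[n]}{t+2}$, $\mathcal{A}(Z)=\{F\in\binom{[n]}{k}:|F\cap Z|\geq t+1\}$, and $\mathcal{A}(n,k,t)=\mathcal{A}([t+2])$; one has $\gamma_t(\mathcal{A}(n,k,t))=t\binom{n-t-2}{k-t-1}$. *)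

theory Defs
  imports Complex_Main "HOL-Library.Ramsey"
begin

definition t_intersecting :: "nat \<Rightarrow> nat set set \<Rightarrow> bool"
  where "t_intersecting t \<F> \<longleftrightarrow> (\<forall>F\<in>\<F>. \<forall>F'\<in>\<F>. t \<le> card (F \<inter> F'))"

(* The maximum is over a nonempty set only when t \<le> n; otherwise Max is unspecified. *)
definition max_t_degree :: "nat \<Rightarrow> nat \<Rightarrow> nat set set \<Rightarrow> nat"
  where "max_t_degree n t \<F> = Max ((\<lambda>S. card {F\<in>\<F>. S \<subseteq> F}) ` nsets {1..n} t)"

(* The natural-number subtraction does not truncate when t \<le> n and the family is finite,
   since every degree is then at most the size of the family. *)
definition t_diversity :: "nat \<Rightarrow> nat \<Rightarrow> nat set set \<Rightarrow> nat"
  where "t_diversity n t \<F> = card \<F> - max_t_degree n t \<F>"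

definition frankl_family :: "nat \<Rightarrow> nat \<Rightarrow> nat \<Rightarrow> nat set \<Rightarrow> nat set set"
  where "frankl_family n k t Z = {F \<in> nsets {1..n} k. t + 1 \<le> card (F \<inter> Z)}"

end

theory Submission
  imports Defs
begin

text \<open>Let \<open>C\<close> be a smallest set meeting every member of the family in at least \<open>t\<close> elements, and write
  \<open>|C| = t + s\<close>. A smaller set fails this for some member, so a partial choice of elements of an
  unknown member can always be extended in at most \<open>k\<close> ways; each extension costs a factor
  \<open>(k - t) / (n - t)\<close>, which is at most both \<open>4 / (21 k)\<close> and \<open>1 / (18 (t + 2))\<close>. Let \<open>S\<close> be the \<open>t\<close>-subset of
  \<open>C\<close> that occurs most often as a trace \<open>F \<inter> C\<close>. Members with traces \<open>S\<close> and \<open>T\<close> share at least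
  \<open>|S - T|\<close> elements outside \<open>C\<close>, and two families that cross-intersect in this way cannot both be
  large; hence all traces \<open>T \<noteq> S\<close> are rare. For \<open>s \<ge> 2\<close> summing these bounds leaves strictly fewer than
  \<open>t ((n - t - 2) choose (k - t - 1))\<close> members not containing \<open>S\<close>. For \<open>s = 1\<close> each of the \<open>t\<close> traces
  \<open>T \<noteq> S\<close> contributes at most the size of a full star, and equality forces the members with trace
  \<open>S\<close> to form the star of some \<open>x\<close>, which puts the family inside the Frankl family of
  \<open>C \<union> {x}\<close>.\<close>

section \<open>Subsets with prescribed traces\<close>

lemma card_nsets_eq: "finite A \<Longrightarrow> card (nsets A k) = card A choose k"
  using n_subsets[of A k] by (simp add: nsets_def finite_subset cong: conj_cong)

lemma card_nsets_trace:
  assumes V: "finite V" "U \<subseteq> V" and "T \<subseteq> U" and k: "card T \<le> k"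
  shows "card {F \<in> nsets V k. F \<inter> U = T} = (card V - card U) choose (k - card T)"
proof -
  have finU: "finite U" using V finite_subset by blast
  then have finT: "finite T" "finite U" using \<open>T \<subseteq> U\<close> finite_subset by auto
  have "bij_betw (\<lambda>F. F - U) {F \<in> nsets V k. F \<inter> U = T} (nsets (V - U) (k - card T))"
  proof (rule bij_betw_byWitness[where f' = "\<lambda>G. G \<union> T"])
    have "card (F - U) = k - card T" if "F \<in> nsets V k" "F \<inter> U = T" for F
      using that finT card_Diff_subset_Int[of F U] by (simp add: nsets_def)
    then show "(\<lambda>F. F - U) ` {F \<in> nsets V k. F \<inter> U = T} \<subseteq> nsets (V - U) (k - card T)"
      by (fastforce simp: nsets_def)
    show "(\<lambda>G. G \<union> T) ` nsets (V - U) (k - card T) \<subseteq> {F \<in> nsets V k. F \<inter> U = T}"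
    proof (rule image_subsetI)
      fix G assume G: "G \<in> nsets (V - U) (k - card T)"
      then have "G \<inter> T = {}" using assms(3) by (auto simp: nsets_def)
      then have "card (G \<union> T) = k" using G k finT by (simp add: nsets_def card_Un_disjoint)
      moreover have "G \<union> T \<subseteq> V" "(G \<union> T) \<inter> U = T" "finite (G \<union> T)"
        using G assms(2,3) finT by (auto simp: nsets_def)
      ultimately show "G \<union> T \<in> {F \<in> nsets V k. F \<inter> U = T}"
        unfolding nsets_def mem_Collect_eq by (intro conjI)
    qed
  qed (use assms(3) in \<open>auto simp: nsets_def\<close>)
  then have "card {F \<in> nsets V k. F \<inter> U = T} = card (nsets (V - U) (k - card T))"
    by (rule bij_betw_same_card)
  then show ?thesis
    using assms finT by (simp add: card_nsets_eq card_Diff_subset)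
qed

text \<open>For \<open>r > k\<close> the truncated difference \<open>k - r\<close> is
  \<open>0\<close> and the binomial coefficient would be \<open>1\<close>, although no
  \<open>k\<close>-set contains an \<open>r\<close>-set; hence the case distinction.\<close>

definition superset_count :: "nat \<Rightarrow> nat \<Rightarrow> nat \<Rightarrow> nat"
  where "superset_count n k r = (if r \<le> k then (n - r) choose (k - r) else 0)"

lemma card_nsets_superset:
  assumes "finite V" "D \<subseteq> V"
  shows "card {F \<in> nsets V k. D \<subseteq> F} = superset_count (card V) k (card D)"
proof (cases "card D \<le> k")
  case True
  have "{F \<in> nsets V k. D \<subseteq> F} = {F \<in> nsets V k. F \<inter> D = D}" by auto
  with True show ?thesis
    using card_nsets_trace[OF assms order_refl True] by (simp add: superset_count_def)
next
  case False
  have none: "{F \<in> nsets V k. D \<subseteq> F} = {}"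
    using False by (auto simp: nsets_def dest: card_mono)
  show ?thesis unfolding none using False by (simp add: superset_count_def)
qed

text \<open>The ratio of consecutive counts is \<open>(n - r) / (k - r)\<close>. Lowering numerator
  and denominator of a fraction that is at least 1 by the same amount \<open>r - t\<close> cannot
  decrease it, so the ratio is still at least \<open>c\<close>.\<close>

lemma superset_count_Suc:
  fixes c :: real
  assumes "k \<le> n" "t \<le> r" "real (k - t) * c \<le> real (n - t)" "1 \<le> c"
  shows "c * superset_count n k (Suc r) \<le> superset_count n k r"
proof (cases "Suc r \<le> k")
  case True
  define a b where "a = n - r" and "b = k - r"
  have ab: "0 < b" "b \<le> a" using True assms by (auto simp: a_def b_def)
  have "real (k - t) = b + real (r - t)" "real (n - t) = a + real (r - t)"
    using assms True by (auto simp: a_def b_def)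
  moreover have "real (r - t) * 1 \<le> real (r - t) * c"
    using assms by (intro mult_left_mono) auto
  ultimately have "b * c \<le> a" using assms(3) by (simp add: distrib_right)
  then have "b * c * ((a - 1) choose (b - 1)) \<le> a * real ((a - 1) choose (b - 1))"
    by (intro mult_right_mono) auto
  also have "\<dots> = b * real (a choose b)"
    by (metis times_binomial_minus1_eq[OF ab(1)] of_nat_mult)
  finally have "c * ((a - 1) choose (b - 1)) \<le> a choose b"
    using ab by (simp add: mult.assoc)
  then show ?thesis using True by (simp add: superset_count_def a_def b_def)
qed (simp add: superset_count_def)

lemma superset_count_add:
  fixes c :: real
  assumes "k \<le> n" "t \<le> r" "real (k - t) * c \<le> real (n - t)" "1 \<le> c"
  shows "c ^ i * superset_count n k (r + i) \<le> superset_count n k r"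
proof (induction i)
  case (Suc i)
  have "c ^ Suc i * superset_count n k (r + Suc i)
      = c ^ i * (c * superset_count n k (Suc (r + i)))" by simp
  also have "\<dots> \<le> c ^ i * superset_count n k (r + i)"
    using assms superset_count_Suc[of k n t "r + i" c] by (intro mult_left_mono) auto
  finally show ?case using Suc by linarith
qed simp

text \<open>While \<open>D'\<close> has fewer than \<open>r\<close> elements, every member of
  \<open>X\<close> containing it has one of the at most \<open>k\<close> elements of
  \<open>G - D'\<close>. Adding such an element repeatedly leads to at most
  \<open>k ^ (r - card D)\<close> sets of size \<open>r\<close> that account for all members. Taking
  \<open>G = {}\<close> expresses that no member contains \<open>D'\<close>.\<close>

lemma branching:
  assumes V: "finite V" and X: "X \<subseteq> nsets V k"
    and "D \<subseteq> V" "card D \<le> r"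
    and br: "\<And>D'. D \<subseteq> D' \<Longrightarrow> D' \<subseteq> V \<Longrightarrow> card D' < r \<Longrightarrow>
      \<exists>G \<subseteq> V. card G \<le> k \<and> (\<forall>F \<in> X. D' \<subseteq> F \<longrightarrow> F \<inter> (G - D') \<noteq> {})"
  shows "card {F \<in> X. D \<subseteq> F} \<le> k ^ (r - card D) * superset_count (card V) k r"
  using assms(3-)
proof (induction "r - card D" arbitrary: D)
  case 0
  have "card {F \<in> X. D \<subseteq> F} \<le> card {F \<in> nsets V k. D \<subseteq> F}"
    using X V by (intro card_mono) (auto simp: finite_imp_finite_nsets)
  with 0 show ?case using card_nsets_superset[OF V 0(2), of k] by simp
next
  case (Suc m)
  have finD: "finite D" using Suc.prems V finite_subset by blast
  have "card D < r" using Suc.hyps(2) by linarith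
  then obtain G where G: "G \<subseteq> V" "card G \<le> k"
      and hit: "\<forall>F \<in> X. D \<subseteq> F \<longrightarrow> F \<inter> (G - D) \<noteq> {}"
    using Suc.prems(3)[of D] Suc.prems(1) by blast
  have finG: "finite G" using G V finite_subset by blast
  have finX: "finite X" using X V finite_imp_finite_nsets finite_subset by blast
  let ?b = "k ^ m * superset_count (card V) k r"
  have step: "card {F \<in> X. insert g D \<subseteq> F} \<le> ?b" if g: "g \<in> G - D" for g
  proof -
    have c: "card (insert g D) = Suc (card D)" using g finD by simp
    have "card {F \<in> X. insert g D \<subseteq> F}
        \<le> k ^ (r - card (insert g D)) * superset_count (card V) k r"
    proof (rule Suc.hyps(1))
      show "m = r - card (insert g D)" "card (insert g D) \<le> r" using c Suc.hyps(2) by auto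
      show "insert g D \<subseteq> V" using g G Suc.prems by auto
      show "\<exists>G \<subseteq> V. card G \<le> k \<and> (\<forall>F \<in> X. D' \<subseteq> F \<longrightarrow> F \<inter> (G - D') \<noteq> {})"
        if "insert g D \<subseteq> D'" "D' \<subseteq> V" "card D' < r" for D'
        using Suc.prems(3)[of D'] that by auto
    qed
    moreover have "r - card (insert g D) = m" using c Suc.hyps(2) by simp
    ultimately show ?thesis by simp
  qed
  have "{F \<in> X. D \<subseteq> F} \<subseteq> (\<Union>g \<in> G - D. {F \<in> X. insert g D \<subseteq> F})"
    using hit by fastforce
  then have "card {F \<in> X. D \<subseteq> F} \<le> card (\<Union>g \<in> G - D. {F \<in> X. insert g D \<subseteq> F})"
    using finG finX by (intro card_mono) auto
  also have "\<dots> \<le> (\<Sum>g \<in> G - D. card {F \<in> X. insert g D \<subseteq> F})"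
    using finG by (intro card_UN_le) auto
  also have "\<dots> \<le> card (G - D) * ?b"
    using step sum_bounded_above[of "G - D" "\<lambda>g. card {F \<in> X. insert g D \<subseteq> F}" ?b] by simp
  also have "\<dots> \<le> k * ?b"
    using G finG by (intro mult_le_mono1) (metis Diff_subset card_mono le_trans)
  also have "\<dots> = k ^ (r - card D) * superset_count (card V) k r"
    by (simp flip: Suc.hyps(2))
  finally show ?case .
qed

section \<open>Numerical estimates\<close>

text \<open>The quotient of the terms for \<open>r + 1\<close> and \<open>r\<close> is
  \<open>x * (r + 1) / (r + 1 - d)\<close>. The last hypothesis makes it at most 1 at
  \<open>r = s\<close>, and \<open>x \<le> 1\<close> carries this to all larger
  \<open>r\<close>.\<close>

lemma choose_mult_power_antimono:
  fixes x :: real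
  assumes "d \<le> s" "s \<le> r" "0 \<le> x" "x \<le> 1" "x * real (Suc s) \<le> real (Suc s - d)"
  shows "(r choose d) * x ^ (r - d) \<le> (s choose d) * x ^ (s - d)"
  using \<open>s \<le> r\<close>
proof (induction r rule: dec_induct)
  case (step r)
  have dr: "d \<le> r" using assms step by simp
  have "x * real (Suc r) = x * real (Suc s) + x * real (r - s)"
    using step by (simp add: algebra_simps of_nat_diff)
  also have "\<dots> \<le> real (Suc s - d) + 1 * real (r - s)"
    using assms by (intro add_mono mult_right_mono) auto
  also have "\<dots> = real (Suc r - d)" using assms(1) step by (simp add: of_nat_diff)
  finally have x: "x * real (Suc r) \<le> real (Suc r - d)" .
  have pos: "0 < real (Suc r - d)" using dr by simp
  have "real (Suc r - d) * ((Suc r choose d) * x ^ (Suc r - d))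
      = real (Suc r * (r choose d)) * x ^ (Suc r - d)"
    using binomial_absorb_comp[of "Suc r" d] by (metis diff_Suc_1 mult.assoc of_nat_mult)
  also have "\<dots> = (x * real (Suc r)) * ((r choose d) * x ^ (r - d))"
    using dr by (simp add: Suc_diff_le algebra_simps)
  also have "\<dots> \<le> real (Suc r - d) * ((r choose d) * x ^ (r - d))"
    using x assms by (intro mult_right_mono) auto
  finally have "(Suc r choose d) * x ^ (Suc r - d) \<le> (r choose d) * x ^ (r - d)"
    using pos by (simp only: mult_le_cancel_left_pos)
  then show ?case using step by linarith
qed simp

text \<open>The final estimate is nearly tight for \<^term>\<open>s = 2\<close>, so there the cruder bound \<open>r choose d \<le> 2 ^ r\<close>
  is not affordable.\<close>

definition decay :: "nat \<Rightarrow> nat \<Rightarrow> real"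
  where "decay s d = (if d = 1 \<or> s = 2 then (s choose d) * (4/21) ^ (s - d)
    else 2 ^ d * (8/21) ^ (s - d))"

lemma decay_nonneg: "0 \<le> decay s d"
  by (simp add: decay_def)

lemma choose_mult_power_le_decay:
  assumes "1 \<le> d" "d \<le> s" "2 \<le> s" "s \<le> r"
  shows "(r choose d) * (4/21) ^ (r - d) \<le> decay s d"
proof (cases "d = 1 \<or> s = 2")
  case True
  \<comment> \<open>For \<open>d = 1\<close> the right side is \<open>s\<close>; for
    \<open>s = 2\<close> it is at least 1 while the left side is 4/7.\<close>
  then have "(4/21) * real (Suc s) \<le> real (Suc s - d)" using assms by auto
  then show ?thesis
    using True assms choose_mult_power_antimono[of d s r "4/21"] by (simp add: decay_def)
next
  case False
  have "real (r choose d) \<le> 2 ^ r" using binomial_le_pow2[of r d] of_nat_mono by fastforce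
  then have "(r choose d) * (4/21::real) ^ (r - d) \<le> 2 ^ (d + (r - d)) * (4/21) ^ (r - d)"
    using assms by (intro mult_right_mono) auto
  also have "\<dots> = 2 ^ d * (8/21) ^ (r - d)"
    unfolding power_add mult.assoc by (simp flip: power_mult_distrib)
  also have "\<dots> \<le> 2 ^ d * (8/21) ^ (s - d)"
    using assms by (intro mult_left_mono power_decreasing) auto
  finally show ?thesis using False by (simp add: decay_def)
qed

section \<open>Weights of traces, and their total\<close>

definition far_weight :: "nat \<Rightarrow> nat \<Rightarrow> nat \<Rightarrow> real"
  where "far_weight t s d = decay s d / (18 * (real t + 2)) ^ (d - 1)"

text \<open>Weights are in units of the number of \<open>k\<close>-sets containing a fixed
  \<open>(t + 1)\<close>-set. This one is for members that also contain a fixed element outside the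
  trace: at distance 1 that saves the factor \<open>s\<close> of \<open>far_weight\<close>, at
  larger distances \<open>far_weight\<close> is kept.\<close>

definition near_weight :: "nat \<Rightarrow> nat \<Rightarrow> nat \<Rightarrow> real"
  where "near_weight t s d = (if d = 1 then (4/21) ^ (s - 1) else far_weight t s d)"

lemma far_weight_nonneg: "0 \<le> far_weight t s d"
  by (simp add: far_weight_def decay_nonneg)

text \<open>For \<open>d \<ge> 2\<close> the binomial coefficient is at most
  \<open>t ^ d / 2\<close>; all but one of the factors \<open>t\<close> are absorbed by
  \<open>t + 2\<close>, so the bound is linear in \<open>t\<close>.\<close>

lemma choose_div_power_le:
  assumes "2 \<le> d"
  shows "(t choose d) / (18 * (real t + 2)) ^ (d - 1) \<le> 9 * real t / 18 ^ d"
proof -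
  obtain e where e: "d = Suc e" "1 \<le> e" using assms by (metis Suc_le_D Suc_le_mono numeral_2_eq_2 One_nat_def)
  have "(2::nat) \<le> fact d" using fact_mono_nat[of 2 d] assms by simp
  then have "(t choose d) * 2 \<le> (t choose d) * fact d" by simp
  also have "\<dots> \<le> t ^ d" by (rule binomial_fact_pow)
  finally have "real ((t choose d) * 2) \<le> real (t ^ d)" by (rule of_nat_mono)
  then have "2 * real (t choose d) \<le> real t * real t ^ e" by (simp add: e(1) del: binomial_Suc_Suc)
  also have "\<dots> \<le> real t * (real t + 2) ^ e"
    by (intro mult_left_mono power_mono) auto
  finally have "real (t choose d) \<le> t / 2 * (real t + 2) ^ e" by simp
  then have "(t choose d) / (18 * (real t + 2)) ^ e \<le> t / 2 * (real t + 2) ^ e / (18 * (real t + 2)) ^ e"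
    by (intro divide_right_mono) auto
  also have "\<dots> = 9 * real t / 18 ^ d" unfolding power_mult_distrib by (simp add: e(1))
  finally show ?thesis by (simp add: e(1) del: binomial_Suc_Suc)
qed

text \<open>Passing from \<open>p\<close> to \<open>p + 1\<close> multiplies the binomial
  coefficient by \<open>(p + 4) / (p + 1)\<close>, which is at most 2 once \<open>p \<ge> 2\<close>.
  Equality holds at \<open>p = 2\<close> and \<open>p = 3\<close>.\<close>

lemma choose_3_le: "2 * ((p + 3) choose 3) \<le> 5 * (2::nat) ^ p"
proof (cases "p \<le> 2")
  case True
  then have "p = 0 \<or> p = 1 \<or> p = 2" by linarith
  then show ?thesis by (auto simp: numeral_eq_Suc)
next
  case False
  then have "2 \<le> p" by simp
  then show ?thesis
  proof (induction p rule: dec_induct)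
    case base
    show ?case by (simp add: numeral_eq_Suc)
  next
    case (step p)
    have "Suc p * ((Suc p + 3) choose 3) = (p + 4) * ((p + 3) choose 3)"
      using binomial_absorb_comp[of "Suc p + 3" 3] by (simp add: add.commute del: binomial_Suc_Suc)
    also have "\<dots> \<le> 2 * Suc p * ((p + 3) choose 3)"
      using step by (intro mult_le_mono1) simp
    finally have "(Suc p + 3) choose 3 \<le> 2 * ((p + 3) choose 3)"
      by (simp only: mult.assoc mult.left_commute[of 2] mult_le_cancel1)
    then show ?case using step.IH by simp
  qed
qed

text \<open>At \<open>s = 3\<close> the value is 24/49, and each step multiplies it by
  \<open>4/21 * ((s + 1) / s) ^ 2 < 1\<close>.\<close>

lemma sq_mult_power_le:
  assumes "3 \<le> s"
  shows "3/2 * real s ^ 2 * (4/21) ^ (s - 1) \<le> 1/2"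
  using assms
proof (induction s rule: dec_induct)
  case (step s)
  have "real (Suc s) ^ 2 * 4 \<le> 21 * real s ^ 2"
  proof -
    have s3: "3 \<le> real s" using step by simp
    then have "3 * real s \<le> real s * real s" by (intro mult_right_mono) auto
    then have "4 + 8 * real s \<le> 17 * (real s * real s)" using s3 by linarith
    then show ?thesis by (simp add: power2_eq_square algebra_simps)
  qed
  then have "3/2 * (real (Suc s) ^ 2 * (4/21)) * (4/21) ^ (s - 1) \<le> 3/2 * real s ^ 2 * (4/21) ^ (s - 1)"
    by (intro mult_right_mono) auto
  moreover have "(4/21::real) ^ (Suc s - 1) = 4/21 * (4/21) ^ (s - 1)"
    using step by (cases s) auto
  then have "3/2 * real (Suc s) ^ 2 * (4/21) ^ (Suc s - 1)
      = 3/2 * (real (Suc s) ^ 2 * (4/21)) * (4/21) ^ (s - 1)"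
    by (simp only: mult.assoc)
  ultimately show ?case using step.IH by linarith
qed (simp add: power2_eq_square)

text \<open>Inserting the factor \<open>Suc d choose 3\<close> turns
  \<open>Suc s choose Suc d\<close> into \<open>Suc s choose 3\<close> times
  \<open>(s - 2) choose (d - 2)\<close>, so the sum becomes the binomial expansion of
  \<open>(1/9 + 8/21) ^ p\<close> with \<open>p = s - 2\<close>. The base is below 1/2, which
  cancels the \<open>2 ^ p\<close> from \<open>choose_3_le\<close>.\<close>

lemma sum_far_weight_le:
  assumes "3 \<le> s"
  shows "(\<Sum>d=2..s. (t choose d) * (Suc s choose Suc d) * far_weight t s d) \<le> 5/18 * t"
proof -
  obtain p where p: "s = p + 2" using assms by (metis add.commute le_Suc_ex add_leD2 numeral_3_eq_3 numeral_2_eq_2 Suc_leD)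
  let ?K = "real ((p + 3) choose 3)"
  have "(t choose d) * (Suc s choose Suc d) * far_weight t s d
      \<le> t / 9 * ?K * ((p choose (d - 2)) * (1/9) ^ (d - 2) * (8/21) ^ (p - (d - 2)))"
    if d: "d \<in> {2..s}" for d
  proof -
    obtain e where e: "d = e + 2" "e \<le> p" using d p by (metis add.commute add_le_cancel_right atLeastAtMost_iff le_Suc_ex)
    have "(Suc s choose Suc d) * 1 \<le> (Suc s choose Suc d) * (Suc d choose 3)"
      using e by (intro mult_le_mono2) (simp add: Suc_leI del: binomial_Suc_Suc)
    also have "\<dots> = (Suc s choose 3) * ((Suc s - 3) choose (Suc d - 3))"
      using e p by (intro choose_mult) auto
    also have "\<dots> = ((p + 3) choose 3) * (p choose e)"
      using e p by (simp add: numeral_eq_Suc del: binomial_Suc_Suc)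
    finally have "real ((Suc s choose Suc d) * 1) \<le> real (((p + 3) choose 3) * (p choose e))"
      by (rule of_nat_mono)
    then have c: "real (Suc s choose Suc d) \<le> ?K * (p choose e)"
      by (simp del: binomial_Suc_Suc)
    have "(t choose d) * (Suc s choose Suc d) * far_weight t s d
        = ((t choose d) / (18 * (real t + 2)) ^ (d - 1)) * (Suc s choose Suc d) * (2 ^ d * (8/21) ^ (p - e))"
      using assms e p by (simp add: far_weight_def decay_def del: binomial_Suc_Suc)
    also have "\<dots> \<le> (9 * real t / 18 ^ d) * (?K * (p choose e)) * (2 ^ d * (8/21) ^ (p - e))"
      using choose_div_power_le[of d t] c e by (intro mult_right_mono mult_mono) auto
    also have "\<dots> = (9 * real t * (2 / 18) ^ d) * (?K * (p choose e)) * (8/21) ^ (p - e)"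
      unfolding power_divide by (simp del: power_mult_numeral)
    also have "\<dots> = t / 9 * ?K * ((p choose e) * (1/9) ^ e * (8/21) ^ (p - e))"
      by (simp add: e(1) power_add power2_eq_square)
    finally show ?thesis by (simp add: e(1))
  qed
  then have "(\<Sum>d=2..s. (t choose d) * (Suc s choose Suc d) * far_weight t s d)
      \<le> (\<Sum>d=2..s. t / 9 * ?K * ((p choose (d - 2)) * (1/9) ^ (d - 2) * (8/21) ^ (p - (d - 2))))"
    by (rule sum_mono)
  also have "\<dots> = t / 9 * ?K * (\<Sum>d=2..s. (p choose (d - 2)) * (1/9) ^ (d - 2) * (8/21) ^ (p - (d - 2)))"
    by (rule sum_distrib_left[symmetric])
  also have "(\<Sum>d=2..s. (p choose (d - 2)) * (1/9) ^ (d - 2) * (8/21::real) ^ (p - (d - 2)))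
      = (\<Sum>e\<le>p. (p choose e) * (1/9) ^ e * (8/21) ^ (p - e))"
    by (rule sum.reindex_bij_witness[of _ "\<lambda>e. e + 2" "\<lambda>d. d - 2"]) (auto simp: p)
  also have "\<dots> = (1/9 + 8/21) ^ p" by (rule binomial_ring[symmetric])
  also have "t / 9 * ?K * (1/9 + 8/21) ^ p \<le> t / 9 * (5/2 * 2 ^ p) * (1/2) ^ p"
  proof (intro mult_mono power_mono)
    have "real (2 * ((p + 3) choose 3)) \<le> real (5 * 2 ^ p)"
      using choose_3_le by (rule of_nat_mono)
    then show "?K \<le> 5/2 * 2 ^ p" by simp
  qed auto
  also have "\<dots> = 5/18 * t" by (simp add: power_divide)
  finally show ?thesis .
qed

text \<open>The first sum stands for the traces of exactly \<open>t\<close> elements, the second for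
  the larger ones, layer by layer. The constant 197/200 lies below 71/72, the share of
  \<open>mu\<close> that \<open>star_size_ge\<close> guarantees.\<close>

lemma total_weight_le:
  assumes t: "2 \<le> t" and s: "2 \<le> s"
  shows "(\<Sum>d=1..s. (t choose d) * (s choose d) * far_weight t s d)
    + (\<Sum>q<s. (if q \<le> 1 then 0 else (4/21) ^ (s - 1))
        + (\<Sum>d=1..q. (t choose d) * (q choose d) * near_weight t s d)) \<le> 197/200 * t"
proof (cases "s = 2")
  case True
  \<comment> \<open>For \<open>s = 2\<close> the terms with \<open>d = 1\<close> add up to
    \<open>20/21 * t\<close>, and the only one with \<open>d = 2\<close> is at most
    \<open>t / 36\<close>.\<close>
  have "(t choose 2) / (18 * (real t + 2)) ^ (2 - 1) \<le> 9 * real t / 18 ^ 2"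
    by (rule choose_div_power_le) simp
  then have "(t choose 2) / (18 * (real t + 2)) \<le> t / 36" by simp
  moreover have "{1..2::nat} = {1, 2}" "{..<2::nat} = {0, 1}" by auto
  ultimately show ?thesis
    using True by (simp add: far_weight_def near_weight_def decay_def)
next
  case False
  then have s3: "3 \<le> s" using s by simp
  define y where "y = (4/21::real) ^ (s - 1)"
  have y: "0 \<le> y" by (simp add: y_def)
  have split: "{1..s} = insert 1 {2..s}" using s by auto
  have near: "(\<Sum>d=1..q. (t choose d) * (q choose d) * near_weight t s d)
      = t * y * q + (\<Sum>d=2..s. (t choose d) * (q choose d) * far_weight t s d)" if "q < s" for q
  proof -
    have "(\<Sum>d=1..q. (t choose d) * (q choose d) * near_weight t s d)
        = (\<Sum>d=1..s. (t choose d) * (q choose d) * near_weight t s d)"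
      using that by (intro sum.mono_neutral_left) (auto simp: binomial_eq_0)
    also have "\<dots> = t * y * q + (\<Sum>d=2..s. (t choose d) * (q choose d) * near_weight t s d)"
      unfolding split by (simp add: near_weight_def y_def)
    also have "(\<Sum>d=2..s. (t choose d) * (q choose d) * near_weight t s d)
        = (\<Sum>d=2..s. (t choose d) * (q choose d) * far_weight t s d)"
      by (intro sum.cong) (auto simp: near_weight_def)
    finally show ?thesis .
  qed
  have gauss: "(\<Sum>q<s. real q) = real s * (real s - 1) / 2"
    by (induction s) (auto simp: field_simps)
  have "(\<Sum>q<s. (if q \<le> 1 then 0 else y)
        + (\<Sum>d=1..q. (t choose d) * (q choose d) * near_weight t s d))
      \<le> (\<Sum>q<s. y + (t * y * q + (\<Sum>d=2..s. (t choose d) * (q choose d) * far_weight t s d)))"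
  proof (intro sum_mono add_mono)
    fix q assume "q \<in> {..<s}"
    then show "(\<Sum>d=1..q. (t choose d) * (q choose d) * near_weight t s d)
        \<le> t * y * q + (\<Sum>d=2..s. (t choose d) * (q choose d) * far_weight t s d)"
      using near[of q] by simp
  qed (use y in auto)
  also have "\<dots> = s * y + t * y * (s * (real s - 1) / 2)
      + (\<Sum>q<s. \<Sum>d=2..s. (t choose d) * (q choose d) * far_weight t s d)"
    by (simp add: sum.distrib sum_distrib_left[symmetric] gauss)
  finally have second: "(\<Sum>q<s. (if q \<le> 1 then 0 else y)
        + (\<Sum>d=1..q. (t choose d) * (q choose d) * near_weight t s d)) \<le> \<dots>" .
  have first: "(\<Sum>d=1..s. (t choose d) * (s choose d) * far_weight t s d)
      = t * y * s ^ 2 + (\<Sum>d=2..s. (t choose d) * (s choose d) * far_weight t s d)"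
    unfolding split by (simp add: far_weight_def decay_def y_def power2_eq_square)
  \<comment> \<open>The bottom layer is the missing term \<open>q = s\<close> of the sum over
    layers. After exchanging the sums, \<open>q choose d\<close> is summed over \<open>q\<close> by
    the hockey-stick identity.\<close>
  have "(\<Sum>q<s. \<Sum>d=2..s. (t choose d) * (q choose d) * far_weight t s d)
      + (\<Sum>d=2..s. (t choose d) * (s choose d) * far_weight t s d)
      = (\<Sum>q\<le>s. \<Sum>d=2..s. (t choose d) * (q choose d) * far_weight t s d)"
    by (simp add: lessThan_Suc_atMost[symmetric])
  also have "\<dots> = (\<Sum>d=2..s. \<Sum>q\<le>s. (t choose d) * (q choose d) * far_weight t s d)"
    by (rule sum.swap)
  also have "\<dots> = (\<Sum>d=2..s. (t choose d) * (Suc s choose Suc d) * far_weight t s d)"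
  proof (intro sum.cong refl)
    fix d
    have "(\<Sum>q\<le>s. (t choose d) * (q choose d) * far_weight t s d)
        = (t choose d) * real (\<Sum>q\<le>s. q choose d) * far_weight t s d"
      by (simp add: sum_distrib_left sum_distrib_right)
    then show "(\<Sum>q\<le>s. (t choose d) * (q choose d) * far_weight t s d)
        = (t choose d) * (Suc s choose Suc d) * far_weight t s d"
      by (simp only: sum_choose_upper of_nat_mult)
  qed
  also have "\<dots> \<le> 5/18 * t" by (rule sum_far_weight_le[OF s3])
  finally have far: "(\<Sum>q<s. \<Sum>d=2..s. (t choose d) * (q choose d) * far_weight t s d)
      + (\<Sum>d=2..s. (t choose d) * (s choose d) * far_weight t s d) \<le> 5/18 * t" .
  \<comment> \<open>The terms with \<open>d = 1\<close> amount to
    \<open>t * y * (3/2 * s ^ 2 - s / 2)\<close>; the negative part absorbs the extra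
    \<open>s * y\<close> because \<open>t \<ge> 2\<close>.\<close>
  have "t * y * s ^ 2 + (s * y + t * y * (s * (real s - 1) / 2)) \<le> t * (3/2 * s ^ 2 * y)"
  proof -
    have "2 * (s * y) \<le> t * (s * y)" using t y by (intro mult_right_mono) auto
    then show ?thesis by (simp add: field_simps power2_eq_square)
  qed
  also have "\<dots> \<le> t * (1/2)"
    using sq_mult_power_le[OF s3] by (intro mult_left_mono) (auto simp: y_def)
  finally show ?thesis
    using second first far t unfolding y_def by linarith
qed

section \<open>Distances between \<open>t\<close>-subsets\<close>

text \<open>\<open>T\<close> corresponds to the pair \<open>(S - T, T - S)\<close>, whose components
  have equal size because \<open>S\<close> and \<open>T\<close> both have \<open>t\<close>
  elements.\<close>

lemma card_nsets_distance:
  assumes "finite C" "S \<subseteq> C" "card S = t" "card C = t + q"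
  shows "card {T \<in> nsets C t. card (S - T) = d} = (t choose d) * (q choose d)"
proof -
  have fin: "finite S" "finite (C - S)" using assms finite_subset by auto
  have sym: "card (T - S) = card (S - T)" if "T \<in> nsets C t" for T
    using that assms(3) fin card_Diff_subset_Int[of S T] card_Diff_subset_Int[of T S]
    by (simp add: nsets_def Int_commute)
  have "bij_betw (\<lambda>T. (S - T, T - S)) {T \<in> nsets C t. card (S - T) = d}
      (nsets S d \<times> nsets (C - S) d)"
  proof (rule bij_betw_byWitness[where f' = "\<lambda>(P, Q). (S - P) \<union> Q"])
    show "(\<lambda>T. (S - T, T - S)) ` {T \<in> nsets C t. card (S - T) = d}
        \<subseteq> nsets S d \<times> nsets (C - S) d"
    proof (rule image_subsetI)
      fix T assume "T \<in> {T \<in> nsets C t. card (S - T) = d}"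
      then show "(S - T, T - S) \<in> nsets S d \<times> nsets (C - S) d"
        using sym[of T] fin by (auto simp: nsets_def)
    qed
    show "(\<lambda>(P, Q). (S - P) \<union> Q) ` (nsets S d \<times> nsets (C - S) d)
        \<subseteq> {T \<in> nsets C t. card (S - T) = d}"
    proof (rule image_subsetI, clarify)
      fix P Q assume PQ: "P \<in> nsets S d" "Q \<in> nsets (C - S) d"
      then have P: "P \<subseteq> S" "finite P" "card P = d" and Q: "Q \<subseteq> C - S" "finite Q" "card Q = d"
        by (auto simp: nsets_def)
      have "card ((S - P) \<union> Q) = card (S - P) + card Q"
        using P Q fin by (intro card_Un_disjoint) auto
      also have "\<dots> = t"
        using P Q fin assms(3) card_mono[of S P] by (simp add: card_Diff_subset)
      finally have "card ((S - P) \<union> Q) = t" .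
      moreover have "S - ((S - P) \<union> Q) = P" using P Q by blast
      moreover have "(S - P) \<union> Q \<subseteq> C" using Q assms(2) by blast
      moreover have "finite ((S - P) \<union> Q)" using fin Q by simp
      ultimately show "(S - P) \<union> Q \<in> nsets C t \<and> card (S - ((S - P) \<union> Q)) = d"
        using P by (simp add: nsets_def)
    qed
    show "\<forall>T \<in> {T \<in> nsets C t. card (S - T) = d}. (case (S - T, T - S) of (P, Q) \<Rightarrow> (S - P) \<union> Q) = T"
      by auto
    show "\<forall>PQ \<in> nsets S d \<times> nsets (C - S) d.
        (S - (case PQ of (P, Q) \<Rightarrow> (S - P) \<union> Q), (case PQ of (P, Q) \<Rightarrow> (S - P) \<union> Q) - S) = PQ"
      by (fastforce simp: nsets_def)
  qed
  then have "card {T \<in> nsets C t. card (S - T) = d} = card (nsets S d \<times> nsets (C - S) d)"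
    by (rule bij_betw_same_card)
  also have "card (C - S) = q" using assms fin by (simp add: card_Diff_subset)
  then have "card (nsets S d \<times> nsets (C - S) d) = (t choose d) * (q choose d)"
    using fin assms(3) by (simp add: card_cartesian_product card_nsets_eq)
  finally show ?thesis .
qed

lemma distance_range:
  assumes "finite C" "S \<subseteq> C" "card S = t" "card C = t + q" "T \<in> nsets C t" "T \<noteq> S"
  shows "card (S - T) \<in> {1..q}"
proof -
  have fin: "finite S" "finite T" using assms finite_subset by (auto simp: nsets_def)
  have T: "card T = t" "T \<subseteq> C" using assms by (auto simp: nsets_def)
  have "card (S - T) = card (T - S)"
    using T assms(3) fin card_Diff_subset_Int[of S T] card_Diff_subset_Int[of T S]
    by (simp add: Int_commute)
  also have "\<dots> \<le> card (C - S)" using T assms(1) by (intro card_mono) auto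
  also have "\<dots> = q" using assms fin by (simp add: card_Diff_subset)
  finally have "card (S - T) \<le> q" .
  moreover have "S - T \<noteq> {}"
  proof
    assume "S - T = {}"
    then have "S = T" using card_subset_eq[of T S] fin T assms(3) by auto
    then show False using assms(6) by simp
  qed
  then have "card (S - T) \<noteq> 0" using fin by simp
  ultimately show ?thesis by simp
qed

lemma sum_over_distance:
  fixes g :: "nat \<Rightarrow> real"
  assumes C: "finite C" "S \<subseteq> C" "card S = t" "card C = t + q"
  shows "(\<Sum>T \<in> nsets C t - {S}. g (card (S - T))) = (\<Sum>d=1..q. (t choose d) * (q choose d) * g d)"
proof -
  let ?N = "nsets C t - {S}"
  have fin: "finite ?N" using C by (simp add: finite_imp_finite_nsets)
  have "(\<lambda>T. card (S - T)) ` ?N \<subseteq> {1..q}"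
    using distance_range[OF C] by (intro image_subsetI) (metis DiffE singletonI)
  then have "(\<Sum>T \<in> ?N. g (card (S - T)))
      = (\<Sum>d \<in> {1..q}. \<Sum>T \<in> {T \<in> ?N. card (S - T) = d}. g (card (S - T)))"
    using fin by (intro sum.group[symmetric]) auto
  also have "\<dots> = (\<Sum>d \<in> {1..q}. (t choose d) * (q choose d) * g d)"
  proof (intro sum.cong refl)
    fix d assume d: "d \<in> {1..q}"
    then have "{T \<in> ?N. card (S - T) = d} = {T \<in> nsets C t. card (S - T) = d}" by auto
    then show "(\<Sum>T \<in> {T \<in> ?N. card (S - T) = d}. g (card (S - T)))
        = (t choose d) * (q choose d) * g d"
      using card_nsets_distance[OF C, of d] by simp
  qed
  finally show ?thesis .
qed

lemma popular_subset_exists: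
  fixes f :: "nat set \<Rightarrow> nat"
  assumes "finite C" "t \<le> card C"
  obtains S where "S \<in> nsets C t" "\<And>T. T \<in> nsets C t \<Longrightarrow> f T \<le> f S"
proof -
  have "finite (nsets C t)" "nsets C t \<noteq> {}"
    using assms by (auto simp: finite_imp_finite_nsets nsets_eq_empty_iff)
  then have "Max (f ` nsets C t) \<in> f ` nsets C t" by (intro Max_in) auto
  then obtain S where "S \<in> nsets C t" "f S = Max (f ` nsets C t)" by (metis imageE)
  then show ?thesis using that \<open>finite (nsets C t)\<close> by (metis Max_ge finite_imageI imageI)
qed

section \<open>Cross-intersecting traces\<close>

locale t_intersecting_family =
  fixes V :: "nat set" and k t :: nat and \<F> :: "nat set set"
  assumes finite_ground: "finite V"
    and uniform: "\<F> \<subseteq> nsets V k"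
    and t_int: "t_intersecting t \<F>"
begin

definition trace :: "nat set \<Rightarrow> nat set \<Rightarrow> nat set set"
  where "trace U S = {F \<in> \<F>. F \<inter> U = S}"

definition no_cover_below :: "nat \<Rightarrow> bool"
  where "no_cover_below q \<longleftrightarrow> (\<forall>D \<subseteq> V. card D < q \<longrightarrow> (\<exists>G \<in> \<F>. card (G \<inter> D) < t))"

lemma finite_family: "finite \<F>"
  using uniform finite_ground finite_imp_finite_nsets finite_subset by blast

lemma memD:
  assumes "F \<in> \<F>"
  shows "F \<subseteq> V" "finite F" "card F = k"
  using assms uniform by (auto simp: nsets_def)

lemma card_inter: "F \<in> \<F> \<Longrightarrow> G \<in> \<F> \<Longrightarrow> t \<le> card (F \<inter> G)"
  using t_int by (auto simp: t_intersecting_def)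

text \<open>Some member \<open>G\<close> meets \<open>D\<close> in fewer than \<open>t\<close>
  elements but meets every \<open>F\<close> in at least \<open>t\<close>, hence also outside
  \<open>D\<close>.\<close>

lemma no_cover_branch:
  assumes "no_cover_below q" "D \<subseteq> V" "card D < q"
  shows "\<exists>G \<subseteq> V. card G \<le> k \<and> (\<forall>F \<in> \<F>. D \<subseteq> F \<longrightarrow> F \<inter> (G - D) \<noteq> {})"
proof -
  obtain G where G: "G \<in> \<F>" "card (G \<inter> D) < t"
    using assms(1)[unfolded no_cover_below_def, rule_format, OF assms(2,3)] by auto
  have finD: "finite D" using assms(2) finite_ground finite_subset by blast
  have "F \<inter> (G - D) \<noteq> {}" if "F \<in> \<F>" for F
  proof
    assume "F \<inter> (G - D) = {}"
    then have "card (F \<inter> G) \<le> card (G \<inter> D)" using finD by (intro card_mono) auto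
    then show False using card_inter[of F G] G that by auto
  qed
  then show ?thesis using G memD by (intro exI[of _ G]) auto
qed

lemma trace_cross:
  assumes A: "A \<in> trace U S" and B: "B \<in> trace U T"
    and "card (S \<inter> T) + d = t"
  shows "d \<le> card (A \<inter> (B - U))"
proof -
  have AB: "A \<in> \<F>" "B \<in> \<F>" "A \<inter> U = S" "B \<inter> U = T"
    using A B by (auto simp: trace_def)
  have "A \<inter> B \<subseteq> (S \<inter> T) \<union> (A \<inter> (B - U))" using AB by blast
  then have "card (A \<inter> B) \<le> card ((S \<inter> T) \<union> (A \<inter> (B - U)))"
    using AB memD by (intro card_mono) (auto intro: finite_subset)
  also have "\<dots> \<le> card (S \<inter> T) + card (A \<inter> (B - U))" by (rule card_Un_le)
  finally show ?thesis using card_inter[OF AB(1,2)] assms(3) by linarith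
qed

text \<open>Every member with trace \<open>T\<close> contains \<open>T \<union> P\<close> for some
  \<open>d\<close>-subset \<open>P\<close> of \<open>C\<close>; from there branching goes from
  \<open>t + d\<close> to \<open>t + r\<close> elements. Branching sets come from the whole family
  below \<open>t + s\<close> elements, and from members with trace \<open>S\<close> while the part
  outside \<open>U\<close> has fewer than \<open>a\<close> elements.\<close>

lemma card_trace_le_covered:
  assumes ST: "T \<subseteq> U" "U \<subseteq> V" "card T = t" and d: "card (S \<inter> T) + d = t"
    and C: "C \<subseteq> V - U" "\<forall>B \<in> trace U T. d \<le> card (B \<inter> C)"
    and small: "\<forall>D \<subseteq> V - U. card D < a \<longrightarrow> (\<exists>G \<in> trace U S. card (G \<inter> D) < d)"
    and nc: "no_cover_below (t + s)"
    and r: "d \<le> r" "r \<le> a \<or> r \<le> s"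
  shows "card (trace U T)
    \<le> (card C choose d) * k ^ (r - d) * superset_count (card V) k (t + r)"
proof -
  let ?B = "trace U T"
  let ?b = "k ^ (r - d) * superset_count (card V) k (t + r)"
  have finU: "finite U" using ST finite_ground finite_subset by blast
  have finC: "finite C" using C finite_ground by (meson finite_Diff finite_subset)
  have finT: "finite T" using ST finU finite_subset by blast
  have BF: "?B \<subseteq> \<F>" by (auto simp: trace_def)
  have each: "card {B \<in> ?B. T \<union> P \<subseteq> B} \<le> ?b" if P: "P \<in> nsets C d" for P
  proof -
    have P': "P \<subseteq> C" "finite P" "card P = d" using P by (auto simp: nsets_def)
    have cTP: "card (T \<union> P) = t + d"
      using P' C ST finT by (subst card_Un_disjoint) auto
    have "card {B \<in> ?B. T \<union> P \<subseteq> B}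
        \<le> k ^ (t + r - card (T \<union> P)) * superset_count (card V) k (t + r)"
    proof (rule branching)
      show "finite V" "?B \<subseteq> nsets V k" using finite_ground BF uniform by auto
      show "T \<union> P \<subseteq> V" using ST P' C by auto
      show "card (T \<union> P) \<le> t + r" using cTP r by simp
      fix D assume D: "T \<union> P \<subseteq> D" "D \<subseteq> V" "card D < t + r"
      have finD: "finite D" using D finite_ground finite_subset by blast
      show "\<exists>G \<subseteq> V. card G \<le> k \<and> (\<forall>F \<in> ?B. D \<subseteq> F \<longrightarrow> F \<inter> (G - D) \<noteq> {})"
        using r(2)
      proof
        assume "r \<le> s"
        then have "card D < t + s" using D by simp
        then obtain G where "G \<subseteq> V" "card G \<le> k"
            "\<forall>F \<in> \<F>. D \<subseteq> F \<longrightarrow> F \<inter> (G - D) \<noteq> {}"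
          using no_cover_branch[OF nc D(2)] by auto
        then show ?thesis using BF by (intro exI[of _ G]) auto
      next
        assume "r \<le> a"
        show ?thesis
        proof (cases "D \<inter> U = T")
          \<comment> \<open>Since \<open>T \<subseteq> D\<close>, the set \<open>D\<close> has an
            element of \<open>U\<close> outside \<open>T\<close>, so no member with trace
            \<open>T\<close> contains it.\<close>
          case False
          have "\<not> D \<subseteq> F" if "F \<in> ?B" for F
            using that False D(1) by (auto simp: trace_def)
          then show ?thesis by (intro exI[of _ "{}"]) auto
        next
          case True
          have "card (D - U) = card D - t"
            using finD True ST(3) finT card_Diff_subset_Int[of D U] by simp
          moreover have "t \<le> card D" using card_mono[OF finD, of T] D(1) ST by auto
          ultimately have "card (D - U) < a" using D(3) \<open>r \<le> a\<close> by linarith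
          then obtain G where G: "G \<in> trace U S" "card (G \<inter> (D - U)) < d"
            using small D(2) by (metis Diff_mono subset_refl)
          have "F \<inter> (G - D) \<noteq> {}" if F: "F \<in> ?B" "D \<subseteq> F" for F
          proof
            assume "F \<inter> (G - D) = {}"
            then have "card (G \<inter> (F - U)) \<le> card (G \<inter> (D - U))"
              using finD by (intro card_mono) auto
            then show False using trace_cross[OF G(1) F(1) d] G(2) by simp
          qed
          moreover have "G \<in> \<F>" using G by (simp add: trace_def)
          ultimately show ?thesis using memD[of G] by (intro exI[of _ G]) auto
        qed
      qed
    qed
    then show ?thesis using cTP by simp
  qed
  have "?B \<subseteq> (\<Union>P \<in> nsets C d. {B \<in> ?B. T \<union> P \<subseteq> B})"
  proof
    fix B assume B: "B \<in> ?B"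
    then obtain P where "P \<subseteq> B \<inter> C" "card P = d" "finite P"
      using C(2) by (meson obtain_subset_with_card_n)
    then show "B \<in> (\<Union>P \<in> nsets C d. {B \<in> ?B. T \<union> P \<subseteq> B})"
      using B by (intro UN_I[of P]) (auto simp: nsets_def trace_def)
  qed
  then have "card ?B \<le> card (\<Union>P \<in> nsets C d. {B \<in> ?B. T \<union> P \<subseteq> B})"
    using finC BF finite_family
    by (intro card_mono) (auto simp: finite_imp_finite_nsets intro: finite_subset)
  also have "\<dots> \<le> (\<Sum>P \<in> nsets C d. card {B \<in> ?B. T \<union> P \<subseteq> B})"
    using finC by (intro card_UN_le) (simp add: finite_imp_finite_nsets)
  also have "\<dots> \<le> card (nsets C d) * ?b"
    using each sum_bounded_above[of "nsets C d" "\<lambda>P. card {B \<in> ?B. T \<union> P \<subseteq> B}" ?b] by simp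
  finally show ?thesis using finC by (simp add: card_nsets_eq mult.assoc)
qed

lemma min_cover_exists:
  assumes C: "C \<subseteq> W" "\<forall>A \<in> X. d \<le> card (A \<inter> C)"
  obtains D where "D \<subseteq> W" "\<forall>A \<in> X. d \<le> card (A \<inter> D)"
    "\<forall>D' \<subseteq> W. card D' < card D \<longrightarrow> (\<exists>A \<in> X. card (A \<inter> D') < d)"
proof -
  obtain D where "D \<subseteq> W \<and> (\<forall>A \<in> X. d \<le> card (A \<inter> D))"
    "\<forall>D'. D' \<subseteq> W \<and> (\<forall>A \<in> X. d \<le> card (A \<inter> D')) \<longrightarrow> card D \<le> card D'"
    using ex_has_least_nat[of "\<lambda>D. D \<subseteq> W \<and> (\<forall>A \<in> X. d \<le> card (A \<inter> D))" C card] C by blast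
  then show ?thesis by (intro that[of D]) (auto simp: not_less[symmetric])
qed

text \<open>If the minimum \<^term>\<open>d\<close>-cover of one trace is no larger than that of the other, branching in
  the former starts from its own small cover and continues up to the larger cover number. Which of
  the two traces gets bounded this way is not known, hence the comparison hypothesis.\<close>

lemma card_smaller_trace:
  assumes ST: "S \<subseteq> U" "T \<subseteq> U" "U \<subseteq> V" "card S = t" "card T = t" and d: "card (S \<inter> T) + d = t"
    and ne: "trace U T \<noteq> {}"
    and le: "card (trace U T) \<le> card (trace U S)"
    and nc: "no_cover_below (t + s)"
  obtains m where
    "\<exists>C \<subseteq> V - U. card C \<le> m \<and> (\<forall>A \<in> trace U S. d \<le> card (A \<inter> C))"
    "\<exists>C \<subseteq> V - U. card C \<le> m \<and> (\<forall>A \<in> trace U T. d \<le> card (A \<inter> C))"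
    "d \<le> m"
    "\<And>r. d \<le> r \<Longrightarrow> r \<le> m \<or> r \<le> s \<Longrightarrow> card (trace U T)
      \<le> (m choose d) * k ^ (r - d) * superset_count (card V) k (t + r)"
proof -
  let ?A = "trace U S" and ?B = "trace U T"
  have finB: "finite ?B" using finite_family by (simp add: trace_def)
  have "card ?A \<noteq> 0" using ne le finB by auto
  then obtain A where A: "A \<in> ?A" by (metis card.empty ex_in_conv)
  obtain B where B: "B \<in> ?B" using ne by blast
  have AV: "A \<subseteq> V" "B \<subseteq> V" using A B memD by (auto simp: trace_def)
  have d': "card (T \<inter> S) + d = t" using d by (simp add: Int_commute)
  \<comment> \<open>A member of one trace, stripped of \<open>U\<close>, meets every member of the
    other in at least \<open>d\<close> elements; so covers exist and least ones can be
    chosen.\<close>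
  obtain CA where CA: "CA \<subseteq> V - U" "\<forall>A \<in> ?A. d \<le> card (A \<inter> CA)"
    "\<forall>D' \<subseteq> V - U. card D' < card CA \<longrightarrow> (\<exists>A \<in> ?A. card (A \<inter> D') < d)"
    by (rule min_cover_exists[of "B - U" "V - U" ?A d]) (use AV B trace_cross[OF _ B d] in auto)
  have "d \<le> card (B' \<inter> (A - U))" if "B' \<in> ?B" for B'
    using trace_cross[of B' U T A S d] that A d' by simp
  then obtain CB where CB: "CB \<subseteq> V - U" "\<forall>A \<in> ?B. d \<le> card (A \<inter> CB)"
    "\<forall>D' \<subseteq> V - U. card D' < card CB \<longrightarrow> (\<exists>A \<in> ?B. card (A \<inter> D') < d)"
    using min_cover_exists[of "A - U" "V - U" ?B d] AV by (metis Diff_mono subset_refl)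
  have finC: "finite CA" "finite CB"
    using CA CB finite_ground by (meson finite_Diff finite_subset)+
  have dA: "d \<le> card CA" using CA(2) A finC by (meson card_mono inf_le2 le_trans)
  define m where "m = max (card CA) (card CB)"
  show ?thesis
  proof (rule that[of m])
    show "\<exists>C \<subseteq> V - U. card C \<le> m \<and> (\<forall>A \<in> ?A. d \<le> card (A \<inter> C))"
      using CA by (intro exI[of _ CA]) (simp add: m_def)
    show "\<exists>C \<subseteq> V - U. card C \<le> m \<and> (\<forall>A \<in> ?B. d \<le> card (A \<inter> C))"
      using CB by (intro exI[of _ CB]) (simp add: m_def)
    show "d \<le> m" using dA by (simp add: m_def)
    fix r assume r: "d \<le> r" "r \<le> m \<or> r \<le> s"
    show "card ?B \<le> (m choose d) * k ^ (r - d) * superset_count (card V) k (t + r)"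
    proof (cases "card CB \<le> card CA")
      case True
      then have m: "m = card CA" by (simp add: m_def)
      have "card ?B \<le> (card CB choose d) * k ^ (r - d) * superset_count (card V) k (t + r)"
        by (rule card_trace_le_covered[OF ST(2,3,5) d CB(1,2) CA(3) nc]) (use r m in auto)
      also have "\<dots> \<le> (m choose d) * k ^ (r - d) * superset_count (card V) k (t + r)"
        using True m by (intro mult_le_mono binomial_right_mono) auto
      finally show ?thesis .
    next
      \<comment> \<open>Here the bound applies to the trace of \<open>S\<close>, and
        \<open>le\<close> transfers it to that of \<open>T\<close>.\<close>
      case False
      then have m: "m = card CB" by (simp add: m_def)
      have "card ?A \<le> (card CA choose d) * k ^ (r - d) * superset_count (card V) k (t + r)"
        by (rule card_trace_le_covered[OF ST(1,3,4) d' CA(1,2) CB(3) nc]) (use r m in auto)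
      also have "\<dots> \<le> (m choose d) * k ^ (r - d) * superset_count (card V) k (t + r)"
        using False m by (intro mult_le_mono binomial_right_mono) auto
      finally show ?thesis using le by simp
    qed
  qed
qed

end

section \<open>Large ground sets\<close>

text \<open>The constant 21/4 is twice 21/8, a rational lower bound for e. Enlarging a prescribed
  set by one element gains \<open>21/4 * k\<close>, which pays for a branching into \<open>k\<close>
  choices, or alternatively \<open>18 * (t + 2)\<close>.\<close>

locale wide_t_intersecting_family = t_intersecting_family +
  assumes t_ge: "2 \<le> t" and k_ge: "t + 2 \<le> k"
    and wide_k: "real (k - t) * (21/4 * k) \<le> real (card V - t)"
    and wide_t: "real (k - t) * (18 * (real t + 2)) \<le> real (card V - t)"
begin

text \<open>The count for a fixed \<open>(t + 1)\<close>-set is the unit of all bounds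
  below.\<close>

abbreviation mu :: real
  where "mu \<equiv> real (superset_count (card V) k (t + 1))"

lemma ground_ge: "k - t \<le> (card V - t) div 72" "t < card V"
proof -
  \<comment> \<open>72 is the value of \<open>18 * (t + 2)\<close> at \<open>t = 2\<close>.\<close>
  have "real (k - t) * 72 \<le> real (k - t) * (18 * (real t + 2))"
    using t_ge by (intro mult_left_mono) auto
  then have "real ((k - t) * 72) \<le> real (card V - t)" using wide_t by simp
  then have *: "(k - t) * 72 \<le> card V - t" by (simp only: of_nat_le_iff)
  then show "k - t \<le> (card V - t) div 72" by (simp add: less_eq_div_iff_mult_less_eq)
  show "t < card V" using * k_ge by simp
qed

lemma k_le: "k \<le> card V"
  using ground_ge k_ge by linarith

section \<open>Bounds for single traces in units of \<open>mu\<close>\<close>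

lemma superset_count_t_step:
  assumes "t \<le> r"
  shows "(18 * (real t + 2)) ^ i * superset_count (card V) k (r + i) \<le> superset_count (card V) k r"
  using superset_count_add[OF k_le assms wide_t] by simp

text \<open>The \<open>r - d\<close> steps beyond size \<open>t + d\<close> each gain
  \<open>21/4 * k\<close>, cancelling a branching factor \<open>k\<close> and leaving 4/21. The
  \<open>d - 1\<close> steps from \<open>t + 1\<close> to \<open>t + d\<close> involve no branching
  and each gain \<open>18 * (t + 2)\<close>.\<close>

lemma branch_count_le:
  assumes "1 \<le> d" "d \<le> r"
  shows "real k ^ (r - d) * superset_count (card V) k (t + r)
    \<le> (4/21) ^ (r - d) / (18 * (real t + 2)) ^ (d - 1) * mu"
proof -
  let ?A = "(21/4 * real k) ^ (r - d)" and ?B = "(18 * (real t + 2)) ^ (d - 1)"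
  have "?A * superset_count (card V) k ((t + d) + (r - d)) \<le> superset_count (card V) k (t + d)"
    using superset_count_add[OF k_le _ wide_k, of "t + d" "r - d"] k_ge by simp
  moreover have "?B * superset_count (card V) k (t + 1 + (d - 1)) \<le> mu"
    using superset_count_t_step[of "t + 1" "d - 1"] by simp
  then have "superset_count (card V) k (t + d) \<le> mu / ?B"
    using assms by (simp add: field_simps)
  ultimately have le: "?A * superset_count (card V) k (t + r) \<le> mu / ?B"
    using assms by simp
  have "real k ^ (r - d) * superset_count (card V) k (t + r)
      = (4/21) ^ (r - d) * (?A * superset_count (card V) k (t + r))"
    by (simp flip: mult.assoc power_mult_distrib)
  also have "\<dots> \<le> (4/21) ^ (r - d) * (mu / ?B)"
    using le by (intro mult_left_mono) auto
  finally show ?thesis by simp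
qed

text \<open>The number \<open>m\<close> from \<open>card_smaller_trace\<close> is unknown, but
  branching up to \<open>r = max m s\<close> is always permitted, and for every
  \<open>r \<ge> s\<close> the resulting bound is at most the one in \<open>decay\<close>.\<close>

lemma card_smaller_trace_le:
  assumes ST: "S \<subseteq> U" "T \<subseteq> U" "U \<subseteq> V" "card S = t" "card T = t"
    and d: "1 \<le> card (S - T)" "card (S - T) \<le> s" and s: "2 \<le> s"
    and le: "card (trace U T) \<le> card (trace U S)" and nc: "no_cover_below (t + s)"
  shows "card (trace U T) \<le> far_weight t s (card (S - T)) * mu"
proof (cases "trace U T = {}")
  case True
  then show ?thesis by (simp add: far_weight_nonneg)
next
  case False
  let ?d = "card (S - T)"
  have "finite S" using ST finite_ground by (meson finite_subset)
  then have dist: "card (S \<inter> T) + ?d = t"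
    using ST card_Diff_subset_Int[of S T] card_mono[of S "S \<inter> T"] by simp
  obtain m where m: "?d \<le> m"
    "\<And>r. ?d \<le> r \<Longrightarrow> r \<le> m \<or> r \<le> s \<Longrightarrow> card (trace U T)
      \<le> (m choose ?d) * k ^ (r - ?d) * superset_count (card V) k (t + r)"
    using card_smaller_trace[OF ST dist False le nc] by metis
  define r where "r = max m s"
  have r: "?d \<le> r" "r \<le> m \<or> r \<le> s" "s \<le> r" using m(1) by (auto simp: r_def)
  have "card (trace U T) \<le> (m choose ?d) * k ^ (r - ?d) * superset_count (card V) k (t + r)"
    by (rule m(2)[OF r(1,2)])
  also have "\<dots> \<le> (r choose ?d) * k ^ (r - ?d) * superset_count (card V) k (t + r)"
    by (intro mult_le_mono1 binomial_right_mono) (simp add: r_def)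
  finally have "real (card (trace U T))
      \<le> (r choose ?d) * (real k ^ (r - ?d) * superset_count (card V) k (t + r))"
    by (metis (mono_tags, lifting) mult.assoc of_nat_le_iff of_nat_mult of_nat_power)
  also have "\<dots> \<le> (r choose ?d) * ((4/21) ^ (r - ?d) / (18 * (real t + 2)) ^ (?d - 1) * mu)"
    by (intro mult_left_mono branch_count_le d r) auto
  also have "\<dots> = ((r choose ?d) * (4/21) ^ (r - ?d)) / (18 * (real t + 2)) ^ (?d - 1) * mu"
    by simp
  also have "\<dots> \<le> far_weight t s ?d * mu"
    unfolding far_weight_def
    by (intro mult_right_mono divide_right_mono choose_mult_power_le_decay d s r) auto
  finally show ?thesis .
qed

lemma card_superset_le:
  assumes "D \<subseteq> V" "card D = t + 1" "1 \<le> s" and nc: "no_cover_below (t + s)"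
  shows "card {F \<in> \<F>. D \<subseteq> F} \<le> (4/21) ^ (s - 1) * mu"
proof -
  have "card {F \<in> \<F>. D \<subseteq> F} \<le> k ^ (t + s - card D) * superset_count (card V) k (t + s)"
    using assms no_cover_branch[OF nc]
    by (intro branching[OF finite_ground uniform]) auto
  then have "real (card {F \<in> \<F>. D \<subseteq> F}) \<le> real (k ^ (s - 1) * superset_count (card V) k (t + s))"
    unfolding of_nat_le_iff using assms by simp
  also have "\<dots> \<le> (4/21) ^ (s - 1) * mu"
    using branch_count_le[of 1 s] assms by simp
  finally show ?thesis .
qed

text \<open>For \<open>q \<le> 1\<close> every \<open>t\<close>-subset other than \<open>S\<close>
  is at distance 1 from \<open>S\<close>, so \<open>S\<close> itself serves as reference. For larger
  \<open>q\<close> a new popular subset is the reference, and its own members add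
  \<open>(4/21) ^ (s - 1)\<close>.\<close>

definition layer_weight :: "nat \<Rightarrow> nat \<Rightarrow> real"
  where "layer_weight s q = (if q \<le> 1 then 0 else (4/21) ^ (s - 1))
    + (\<Sum>d=1..q. (t choose d) * (q choose d) * near_weight t s d)"

text \<open>A member counted here contains \<open>insert c T\<close> for its trace \<open>T\<close>,
  which gives \<open>(4/21) ^ (s - 1)\<close>. At distance at least 2 from a popular trace the
  cross-intersection bound is used instead.\<close>

lemma card_layer_le:
  assumes SC: "S \<subseteq> C" "C \<subseteq> V" "card S = t" "card C = t + q"
    and q: "q < s" and s: "2 \<le> s" and c: "c \<in> V - C" and nc: "no_cover_below (t + s)"
  shows "card {F \<in> \<F>. c \<in> F \<and> card (F \<inter> C) = t \<and> \<not> S \<subseteq> F} \<le> layer_weight s q * mu"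
proof -
  let ?h = "\<lambda>T. card {F \<in> trace C T. c \<in> F}"
  have finC: "finite C" using SC finite_ground finite_subset by blast
  have fint: "finite (trace C T)" for T using finite_family by (simp add: trace_def)
  have finN: "finite (nsets C t)" using finC by (rule finite_imp_finite_nsets)
  have N: "T \<subseteq> C" "card T = t" if "T \<in> nsets C t" for T using that by (auto simp: nsets_def)
  have near: "?h T \<le> (4/21) ^ (s - 1) * mu" if T: "T \<in> nsets C t" for T
  proof -
    have "finite T" using T by (simp add: nsets_def)
    then have "card (insert c T) = t + 1" using N[OF T] c by (subst card_insert_disjoint) auto
    then have "card {F \<in> \<F>. insert c T \<subseteq> F} \<le> (4/21) ^ (s - 1) * mu"
      using N[OF T] c SC s by (intro card_superset_le[OF _ _ _ nc]) auto
    moreover have "?h T \<le> card {F \<in> \<F>. insert c T \<subseteq> F}"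
      using finite_family by (intro card_mono) (auto simp: trace_def)
    ultimately show ?thesis by linarith
  qed
  have "{F \<in> \<F>. c \<in> F \<and> card (F \<inter> C) = t \<and> \<not> S \<subseteq> F}
      \<subseteq> (\<Union>T \<in> nsets C t - {S}. {F \<in> trace C T. c \<in> F})"
  proof
    fix F assume F: "F \<in> {F \<in> \<F>. c \<in> F \<and> card (F \<inter> C) = t \<and> \<not> S \<subseteq> F}"
    then have "F \<inter> C \<in> nsets C t - {S}" using finC by (auto simp: nsets_def)
    then show "F \<in> (\<Union>T \<in> nsets C t - {S}. {F \<in> trace C T. c \<in> F})"
      using F by (intro UN_I[of "F \<inter> C"]) (auto simp: trace_def)
  qed
  then have "card {F \<in> \<F>. c \<in> F \<and> card (F \<inter> C) = t \<and> \<not> S \<subseteq> F}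
      \<le> card (\<Union>T \<in> nsets C t - {S}. {F \<in> trace C T. c \<in> F})"
    using finN fint by (intro card_mono) auto
  also have "\<dots> \<le> (\<Sum>T \<in> nsets C t - {S}. ?h T)"
    using finN by (intro card_UN_le) auto
  finally have "real (card {F \<in> \<F>. c \<in> F \<and> card (F \<inter> C) = t \<and> \<not> S \<subseteq> F})
      \<le> real (\<Sum>T \<in> nsets C t - {S}. ?h T)" by (rule of_nat_mono)
  also have "\<dots> = (\<Sum>T \<in> nsets C t - {S}. real (?h T))" by simp
  also have "\<dots> \<le> layer_weight s q * mu"
  proof (cases "q \<le> 1")
    case True
    have "(\<Sum>T \<in> nsets C t - {S}. real (?h T))
        \<le> (\<Sum>T \<in> nsets C t - {S}. near_weight t s (card (S - T)) * mu)"
    proof (rule sum_mono)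
      fix T assume T: "T \<in> nsets C t - {S}"
      then have "card (S - T) \<in> {1..q}"
        using distance_range[OF finC SC(1,3,4), of T] by auto
      then have "card (S - T) = 1" using True by auto
      then show "?h T \<le> near_weight t s (card (S - T)) * mu"
        using near[of T] T by (simp add: near_weight_def)
    qed
    also have "\<dots> = (\<Sum>T \<in> nsets C t - {S}. near_weight t s (card (S - T))) * mu"
      by (rule sum_distrib_right[symmetric])
    also have "\<dots> = layer_weight s q * mu"
      using True by (simp only: sum_over_distance[OF finC SC(1,3,4)] layer_weight_def) simp
    finally show ?thesis .
  next
    case False
    \<comment> \<open>\<open>S\<close> need not be the most frequent trace on this \<open>C\<close>,
      so a new reference \<open>P\<close> is taken; the exclusion of \<open>S\<close> is given up
      and \<open>P\<close> is counted too.\<close>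
    obtain P where P: "P \<in> nsets C t"
      "\<And>T. T \<in> nsets C t \<Longrightarrow> card (trace C T) \<le> card (trace C P)"
      using popular_subset_exists[of C t "\<lambda>T. card (trace C T)"] finC SC(4) by auto
    have far: "?h T \<le> near_weight t s (card (P - T)) * mu" if T: "T \<in> nsets C t - {P}" for T
    proof -
      have d: "card (P - T) \<in> {1..q}"
        using distance_range[OF finC _ _ SC(4), of P T] N[OF P(1)] T by auto
      show ?thesis
      proof (cases "card (P - T) = 1")
        case True
        then show ?thesis using near[of T] T by (simp add: near_weight_def)
      next
        case ne: False
        have "?h T \<le> card (trace C T)" using fint by (intro card_mono) auto
        also have "real (card (trace C T)) \<le> far_weight t s (card (P - T)) * mu"
          using N[OF P(1)] N[of T] T d q s SC(2) P(2)
          by (intro card_smaller_trace_le[OF _ _ _ _ _ _ _ _ _ nc]) auto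
        finally show ?thesis using ne by (simp add: near_weight_def)
      qed
    qed
    have "(\<Sum>T \<in> nsets C t - {S}. real (?h T)) \<le> (\<Sum>T \<in> nsets C t. real (?h T))"
      using finN by (intro sum_mono2) auto
    also have "\<dots> = ?h P + (\<Sum>T \<in> nsets C t - {P}. real (?h T))"
      using finN P(1) by (rule sum.remove)
    also have "\<dots> \<le> (4/21) ^ (s - 1) * mu
        + (\<Sum>T \<in> nsets C t - {P}. near_weight t s (card (P - T)) * mu)"
      using near[OF P(1)] far by (intro add_mono sum_mono) auto
    also have "(\<Sum>T \<in> nsets C t - {P}. near_weight t s (card (P - T)) * mu)
        = (\<Sum>T \<in> nsets C t - {P}. near_weight t s (card (P - T))) * mu"
      by (rule sum_distrib_right[symmetric])
    also have "(\<Sum>T \<in> nsets C t - {P}. near_weight t s (card (P - T)))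
        = (\<Sum>d=1..q. (t choose d) * (q choose d) * near_weight t s d)"
      using sum_over_distance[OF finC _ _ SC(4)] N[OF P(1)] by blast
    finally show ?thesis using False by (simp add: layer_weight_def distrib_right)
  qed
  finally show ?thesis .
qed

text \<open>Deleting an element \<^term>\<open>c\<close> of \<^term>\<open>C - S\<close> from \<^term>\<open>C\<close> leaves the members meeting
  \<^term>\<open>C - {c}\<close> in exactly \<^term>\<open>t\<close> elements; all of these contain \<^term>\<open>c\<close>, which is what gains a
  factor over the bottom layer.\<close>

lemma card_upper_layers_le:
  assumes "S \<subseteq> C" "C \<subseteq> V" "card S = t" "card C = t + q" "q \<le> s"
    and s: "2 \<le> s" and nc: "no_cover_below (t + s)"
  shows "card {F \<in> \<F>. t + 1 \<le> card (F \<inter> C) \<and> \<not> S \<subseteq> F} \<le> (\<Sum>p<q. layer_weight s p) * mu"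
  using assms(1-5)
proof (induction q arbitrary: C)
  case 0
  have finC: "finite C" using 0 finite_ground finite_subset by blast
  have none: "{F \<in> \<F>. t + 1 \<le> card (F \<inter> C) \<and> \<not> S \<subseteq> F} = {}"
  proof -
    have "card (F \<inter> C) \<le> t" for F using card_mono[OF finC, of "F \<inter> C"] 0(4) by simp
    then show ?thesis by (simp add: not_le less_Suc_eq_le)
  qed
  show ?case unfolding none by simp
next
  case (Suc q)
  have finC: "finite C" using Suc.prems finite_ground finite_subset by blast
  have "C \<noteq> S" using Suc.prems by auto
  then obtain c where c: "c \<in> C" "c \<notin> S" using Suc.prems by blast
  let ?D = "C - {c}"
  let ?X = "{F \<in> \<F>. t + 1 \<le> card (F \<inter> ?D) \<and> \<not> S \<subseteq> F}"
  let ?Y = "{F \<in> \<F>. c \<in> F \<and> card (F \<inter> ?D) = t \<and> \<not> S \<subseteq> F}"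
  have D: "S \<subseteq> ?D" "?D \<subseteq> V" "card ?D = t + q" "c \<in> V - ?D"
    using Suc.prems c finC by auto
  have "{F \<in> \<F>. t + 1 \<le> card (F \<inter> C) \<and> \<not> S \<subseteq> F} \<subseteq> ?X \<union> ?Y"
  proof
    fix F assume F: "F \<in> {F \<in> \<F>. t + 1 \<le> card (F \<inter> C) \<and> \<not> S \<subseteq> F}"
    show "F \<in> ?X \<union> ?Y"
    proof (cases "t + 1 \<le> card (F \<inter> ?D)")
      case False
      have eq: "F \<inter> C = (if c \<in> F then insert c (F \<inter> ?D) else F \<inter> ?D)" using c by auto
      have "card (insert c (F \<inter> ?D)) = Suc (card (F \<inter> ?D))" using finC by simp
      then show ?thesis using F False eq by (auto split: if_splits)
    qed (use F in auto)
  qed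
  then have "card {F \<in> \<F>. t + 1 \<le> card (F \<inter> C) \<and> \<not> S \<subseteq> F} \<le> card (?X \<union> ?Y)"
    using finite_family by (intro card_mono) auto
  also have "\<dots> \<le> card ?X + card ?Y" by (rule card_Un_le)
  finally have "real (card {F \<in> \<F>. t + 1 \<le> card (F \<inter> C) \<and> \<not> S \<subseteq> F}) \<le> real (card ?X) + card ?Y"
    using of_nat_mono by fastforce
  moreover have "card ?X \<le> (\<Sum>p<q. layer_weight s p) * mu"
    using D Suc.prems by (intro Suc.IH) auto
  moreover have "card ?Y \<le> layer_weight s q * mu"
    using D Suc.prems s by (intro card_layer_le[OF _ _ _ _ _ _ _ nc]) auto
  ultimately show ?case by (simp add: distrib_right)
qed

section \<open>Smallest covers with at least \<open>t + 2\<close> elements\<close>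

lemma card_not_superset_le_weight:
  assumes C: "C \<subseteq> V" "card C = t + s" "\<forall>F \<in> \<F>. t \<le> card (F \<inter> C)"
    and s: "2 \<le> s" and nc: "no_cover_below (t + s)"
  obtains S where "S \<in> nsets V t" "card {F \<in> \<F>. \<not> S \<subseteq> F} \<le> 197/200 * t * mu"
proof -
  have finC: "finite C" using C finite_ground finite_subset by blast
  have finN: "finite (nsets C t)" using finC by (rule finite_imp_finite_nsets)
  have fint: "finite (trace C T)" for T using finite_family by (simp add: trace_def)
  obtain S where S: "S \<in> nsets C t"
    "\<And>T. T \<in> nsets C t \<Longrightarrow> card (trace C T) \<le> card (trace C S)"
    using popular_subset_exists[of C t "\<lambda>T. card (trace C T)"] finC C(2) by auto
  have SC: "S \<subseteq> C" "card S = t" using S(1) by (auto simp: nsets_def)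
  let ?X = "{F \<in> \<F>. t + 1 \<le> card (F \<inter> C) \<and> \<not> S \<subseteq> F}"
  let ?Y = "\<Union>T \<in> nsets C t - {S}. trace C T"
  have "{F \<in> \<F>. \<not> S \<subseteq> F} \<subseteq> ?X \<union> ?Y"
  proof
    fix F assume F: "F \<in> {F \<in> \<F>. \<not> S \<subseteq> F}"
    show "F \<in> ?X \<union> ?Y"
    proof (cases "card (F \<inter> C) = t")
      case True
      then have "F \<inter> C \<in> nsets C t - {S}" using F finC by (auto simp: nsets_def)
      then have "F \<in> ?Y" using F by (intro UN_I[of "F \<inter> C"]) (auto simp: trace_def)
      then show ?thesis by simp
    next
      case False
      then have "t + 1 \<le> card (F \<inter> C)" using F C(3) by (simp add: Suc_le_eq order.not_eq_order_implies_strict)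
      then show ?thesis using F by simp
    qed
  qed
  then have "card {F \<in> \<F>. \<not> S \<subseteq> F} \<le> card (?X \<union> ?Y)"
    using finite_family finN fint by (intro card_mono) auto
  also have "\<dots> \<le> card ?X + card ?Y" by (rule card_Un_le)
  also have "card ?Y \<le> (\<Sum>T \<in> nsets C t - {S}. card (trace C T))"
    using finN by (intro card_UN_le) auto
  finally have "real (card {F \<in> \<F>. \<not> S \<subseteq> F})
      \<le> real (card ?X + (\<Sum>T \<in> nsets C t - {S}. card (trace C T)))"
    by (intro of_nat_mono) simp
  also have "\<dots> = card ?X + (\<Sum>T \<in> nsets C t - {S}. real (card (trace C T)))"
    by simp
  also have "\<dots> \<le> (\<Sum>p<s. layer_weight s p) * mu
      + (\<Sum>T \<in> nsets C t - {S}. far_weight t s (card (S - T)) * mu)"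
  proof (intro add_mono sum_mono)
    show "card ?X \<le> (\<Sum>p<s. layer_weight s p) * mu"
      using SC C s by (intro card_upper_layers_le[OF _ _ _ _ _ _ nc]) auto
    fix T assume T: "T \<in> nsets C t - {S}"
    have "card (S - T) \<in> {1..s}"
      using distance_range[OF finC SC C(2), of T] T by auto
    then show "card (trace C T) \<le> far_weight t s (card (S - T)) * mu"
      using T SC C S(2)[of T] s
      by (intro card_smaller_trace_le[OF _ _ _ _ _ _ _ _ _ nc]) (auto simp: nsets_def)
  qed
  also have "(\<Sum>T \<in> nsets C t - {S}. far_weight t s (card (S - T)) * mu)
      = (\<Sum>T \<in> nsets C t - {S}. far_weight t s (card (S - T))) * mu"
    by (rule sum_distrib_right[symmetric])
  also have "(\<Sum>T \<in> nsets C t - {S}. far_weight t s (card (S - T)))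
      = (\<Sum>d=1..s. (t choose d) * (s choose d) * far_weight t s d)"
    by (rule sum_over_distance[OF finC SC C(2)])
  also have "(\<Sum>p<s. layer_weight s p) * mu
        + (\<Sum>d=1..s. (t choose d) * (s choose d) * far_weight t s d) * mu
      = ((\<Sum>d=1..s. (t choose d) * (s choose d) * far_weight t s d)
        + (\<Sum>p<s. layer_weight s p)) * mu"
    by (simp add: distrib_right)
  also have "\<dots> \<le> 197/200 * t * mu"
    unfolding layer_weight_def by (intro mult_right_mono total_weight_le t_ge s) simp
  finally show ?thesis using that[of S] S(1) C(1) nsets_mono by blast
qed

subsection \<open>A cover with one extra element\<close>

text \<open>The number of \<open>k\<close>-subsets of \<open>V\<close> with a prescribed trace of
  \<open>t + 1\<close> elements on a \<open>(t + 2)\<close>-set; \<open>t\<close> times it is the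
  bound to be reached.\<close>

abbreviation star_size :: nat
  where "star_size \<equiv> (card V - (t + 2)) choose (k - (t + 1))"

lemma mu_pos: "0 < mu"
proof -
  have "0 < (card V - (t + 1)) choose (k - (t + 1))"
    using k_le by (intro zero_less_binomial) (rule diff_le_mono)
  moreover have "t + 1 \<le> k" using k_ge by simp
  ultimately show ?thesis by (simp only: superset_count_def if_True of_nat_0_less_iff)
qed

text \<open>By Pascal's rule \<open>mu\<close> is this number plus the count for
  \<open>t + 2\<close> prescribed elements, which is at most \<open>mu / 72\<close>.\<close>

lemma star_size_ge: "71/72 * mu \<le> star_size"
proof -
  define a b where "a = card V - (t + 2)" and "b = k - (t + 2)"
  have ab: "card V - (t + 1) = Suc a" "k - (t + 1) = Suc b"
    using k_le k_ge by (auto simp: a_def b_def)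
  then have "superset_count (card V) k (t + 1) = superset_count (card V) k (t + 2) + star_size"
    using k_ge unfolding superset_count_def by (simp add: a_def b_def)
  moreover have "72 * real (superset_count (card V) k (t + 2)) \<le> mu"
  proof -
    have "72 * real (superset_count (card V) k (t + 2))
        \<le> (18 * (real t + 2)) * superset_count (card V) k (t + 2)"
      using t_ge by (intro mult_right_mono) auto
    also have "\<dots> \<le> mu" using superset_count_t_step[of "t + 1" 1] by simp
    finally show ?thesis .
  qed
  ultimately show ?thesis by simp
qed

lemma star_size_pos: "0 < star_size"
proof -
  have "0 < real star_size" using star_size_ge mu_pos by linarith
  then show ?thesis by (simp only: of_nat_0_less_iff)
qed

lemma covered_trace_subset_star:
  assumes W: "W \<subseteq> V" "T \<subseteq> W" and C: "C \<subseteq> V - W" "card C \<le> 1"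
    "\<forall>A \<in> trace W T. 1 \<le> card (A \<inter> C)" and ne: "trace W T \<noteq> {}"
  obtains y where "y \<in> V - W" "trace W T \<subseteq> {F \<in> nsets V k. F \<inter> insert y W = insert y T}"
proof -
  obtain A where A: "A \<in> trace W T" using ne by blast
  have finC: "finite C" using C finite_ground by (meson finite_Diff finite_subset)
  have "1 \<le> card (A \<inter> C)" using A C by blast
  also have "\<dots> \<le> card C" using finC by (intro card_mono) auto
  finally have "card C = 1" using C(2) by simp
  then obtain y where y: "C = {y}" by (rule card_1_singletonE)
  have "trace W T \<subseteq> {F \<in> nsets V k. F \<inter> insert y W = insert y T}"
  proof
    fix F assume F: "F \<in> trace W T"
    then have "y \<in> F" using C(3) y by (cases "y \<in> F") fastforce+
    then show "F \<in> {F \<in> nsets V k. F \<inter> insert y W = insert y T}"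
      using F uniform by (auto simp: trace_def)
  qed
  then show ?thesis using that[of y] y C by auto
qed

lemma card_star:
  assumes "W \<subseteq> V" "T \<subseteq> W" "card W = t + 1" "card T = t" "y \<in> V - W"
  shows "card {F \<in> nsets V k. F \<inter> insert y W = insert y T} = star_size"
proof -
  have fin: "finite W" "finite T" using assms finite_ground by (auto intro: finite_subset)
  have "y \<notin> T" using assms by auto
  then have c: "card (insert y W) = t + 2" "card (insert y T) = t + 1" using assms fin by auto
  then show ?thesis
    using card_nsets_trace[OF finite_ground, of "insert y W" "insert y T" k] assms k_ge by auto
qed

text \<open>Distinct \<open>t\<close>-subsets of \<open>W\<close> are at distance 1. If both traces
  have one-element covers, each lies in a star of \<open>star_size\<close> sets, and equality for
  the smaller trace forces the larger one to fill its star. Otherwise \<open>m \<ge> 2\<close>, and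
  \<open>m * (4/21) ^ (m - 1)\<close> is at most its value 8/21 at \<open>m = 2\<close>, which
  leaves a strict inequality.\<close>

lemma card_smaller_trace_le_star_size:
  assumes W: "W \<subseteq> V" "card W = t + 1" and ST: "S \<in> nsets W t" "T \<in> nsets W t" "T \<noteq> S"
    and le: "card (trace W T) \<le> card (trace W S)" and nc: "no_cover_below (t + 1)"
  shows "card (trace W T) \<le> star_size"
    and "card (trace W T) = star_size \<Longrightarrow>
      \<exists>x \<in> V - W. trace W S = {F \<in> nsets V k. F \<inter> insert x W = insert x S}"
proof -
  have finW: "finite W" using W finite_ground finite_subset by blast
  have S: "S \<subseteq> W" "card S = t" and T: "T \<subseteq> W" "card T = t" using ST by (auto simp: nsets_def)
  have "card (S - T) \<in> {1..1}"
    by (rule distance_range[OF finW S(1,2) _ ST(2,3)]) (use W in simp)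
  moreover have "finite S" using S finW finite_subset by blast
  ultimately have dist: "card (S \<inter> T) + 1 = t"
    using S card_Diff_subset_Int[of S T] card_mono[of S "S \<inter> T"] by simp
  have "card (trace W T) \<le> star_size \<and> (card (trace W T) = star_size \<longrightarrow>
      (\<exists>x \<in> V - W. trace W S = {F \<in> nsets V k. F \<inter> insert x W = insert x S}))"
  proof (cases "trace W T = {}")
    case True
    then show ?thesis using star_size_pos by simp
  next
    case ne: False
    obtain m where
      CS: "\<exists>C \<subseteq> V - W. card C \<le> m \<and> (\<forall>A \<in> trace W S. 1 \<le> card (A \<inter> C))" and
      CT: "\<exists>C \<subseteq> V - W. card C \<le> m \<and> (\<forall>A \<in> trace W T. 1 \<le> card (A \<inter> C))" and
      m: "1 \<le> m" and
      bound: "\<And>r. 1 \<le> r \<Longrightarrow> r \<le> m \<or> r \<le> 1 \<Longrightarrow> card (trace W T)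
        \<le> (m choose 1) * k ^ (r - 1) * superset_count (card V) k (t + r)"
      using card_smaller_trace[OF S(1) T(1) W(1) S(2) T(2) dist ne le nc] by metis
    show ?thesis
    proof (cases "m = 1")
      case True
      have "card (trace W T) \<noteq> 0" using ne finite_family by (simp add: trace_def)
      then have neS: "trace W S \<noteq> {}" using le by auto
      obtain CS' where CS': "CS' \<subseteq> V - W" "card CS' \<le> 1" "\<forall>A \<in> trace W S. 1 \<le> card (A \<inter> CS')"
        using CS True by auto
      obtain CT' where CT': "CT' \<subseteq> V - W" "card CT' \<le> 1" "\<forall>A \<in> trace W T. 1 \<le> card (A \<inter> CT')"
        using CT True by auto
      obtain x where x: "x \<in> V - W" "trace W S \<subseteq> {F \<in> nsets V k. F \<inter> insert x W = insert x S}"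
        by (rule covered_trace_subset_star[OF W(1) S(1) CS' neS])
      obtain y where y: "y \<in> V - W" "trace W T \<subseteq> {F \<in> nsets V k. F \<inter> insert y W = insert y T}"
        by (rule covered_trace_subset_star[OF W(1) T(1) CT' ne])
      have fin: "finite {F \<in> nsets V k. P F}" for P
        using finite_imp_finite_nsets[OF finite_ground] by simp
      have "card (trace W T) \<le> star_size"
        using card_mono[OF fin y(2)] card_star[OF W(1) T(1) W(2) T(2) y(1)] by simp
      moreover have "trace W S = {F \<in> nsets V k. F \<inter> insert x W = insert x S}"
        if "card (trace W T) = star_size"
      proof (rule card_seteq[OF fin x(2)])
        show "card {F \<in> nsets V k. F \<inter> insert x W = insert x S} \<le> card (trace W S)"
          using card_star[OF W(1) S(1) W(2) S(2) x(1)] that le by simp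
      qed
      ultimately show ?thesis using x(1) by blast
    next
      case False
      then have m2: "2 \<le> m" using m by simp
      have "real (card (trace W T)) \<le> real (m * (k ^ (m - 1) * superset_count (card V) k (t + m)))"
        using bound[of m] m unfolding of_nat_le_iff by simp
      also have "\<dots> = m * (real k ^ (m - 1) * superset_count (card V) k (t + m))" by simp
      also have "\<dots> \<le> m * ((4/21) ^ (m - 1) * mu)"
        using branch_count_le[of 1 m] m by (intro mult_left_mono) auto
      also have "\<dots> = (m choose 1) * (4/21) ^ (m - 1) * mu" by simp
      also have "\<dots> \<le> (2 choose 1) * (4/21) ^ (2 - 1) * mu"
        using m2 by (intro mult_right_mono choose_mult_power_antimono) auto
      also have "\<dots> < 71/72 * mu" using mu_pos by simp
      also have "\<dots> \<le> star_size" by (rule star_size_ge)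
      finally show ?thesis by simp
    qed
  qed
  then show "card (trace W T) \<le> star_size"
    and "card (trace W T) = star_size \<Longrightarrow>
      \<exists>x \<in> V - W. trace W S = {F \<in> nsets V k. F \<inter> insert x W = insert x S}" by auto
qed

text \<open>If \<open>F\<close> met \<open>insert x W\<close> in only \<open>t\<close> elements, it
  would miss \<open>x\<close> and have a trace on \<open>W\<close> other than \<open>S\<close>. The
  full star then contains \<open>insert x S\<close> extended by elements outside \<open>F\<close>, a
  member meeting \<open>F\<close> only in \<open>S \<inter> F\<close>, in fewer than
  \<open>t\<close> elements.\<close>

lemma near_star_contained:
  assumes W: "W \<subseteq> V" "card W = t + 1" "\<forall>F \<in> \<F>. t \<le> card (F \<inter> W)"
    and S: "S \<subseteq> W" "card S = t" and x: "x \<in> V - W"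
    and star: "trace W S = {F \<in> nsets V k. F \<inter> insert x W = insert x S}"
    and F: "F \<in> \<F>"
  shows "t + 1 \<le> card (F \<inter> insert x W)"
proof (rule ccontr)
  assume small: "\<not> t + 1 \<le> card (F \<inter> insert x W)"
  have finW: "finite W" using W finite_ground finite_subset by blast
  have finF: "finite F" using memD[OF F] by simp
  have "card (F \<inter> W) \<le> card (F \<inter> insert x W)" using finW by (intro card_mono) auto
  then have FW: "card (F \<inter> W) = t" using small W(3) F by force
  have xF: "x \<notin> F"
  proof
    assume "x \<in> F"
    then have "F \<inter> insert x W = insert x (F \<inter> W)" by auto
    then show False using small FW x finW by simp
  qed
  have "F \<inter> W \<noteq> S"
  proof
    assume "F \<inter> W = S"
    then have "F \<in> trace W S" using F by (simp add: trace_def)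
    then have "F \<inter> insert x W = insert x S" using star by simp
    then show False using xF by blast
  qed
  then have ST: "S \<inter> F \<subset> S"
    using S FW finW by (metis Int_commute Int_subset_iff card_subset_eq finite_Int inf_le2 psubsetI)
  have finS: "finite S" using S finW finite_subset by blast
  have "card (F \<union> insert x W) \<le> k + (t + 2)"
    using card_Un_le[of F "insert x W"] memD[OF F] W(2) card_insert_le_m1[of "t + 2" W x] by simp
  \<comment> \<open>As the union has at most \<open>k + t + 2\<close> elements, this leaves the
    \<open>k - (t + 1)\<close> elements outside it that complete the member of the star.\<close>
  moreover have "2 * k + 1 \<le> card V"
  proof -
    have "2 * (21/4 * real k) \<le> real (k - t) * (21/4 * k)"
      using k_ge by (intro mult_right_mono) auto
    then have "2 * (21/4 * real k) \<le> card V" using wide_k by linarith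
    moreover have "2 \<le> real k" using k_ge by simp
    ultimately have "real (2 * k + 1) \<le> real (card V)" by simp
    then show ?thesis by (simp only: of_nat_le_iff)
  qed
  ultimately have "k - (t + 1) \<le> card (V - (F \<union> insert x W))"
    using finF finW memD(1)[OF F] W(1) x by (subst card_Diff_subset) auto
  then obtain Q where Q: "Q \<subseteq> V - (F \<union> insert x W)" "card Q = k - (t + 1)" "finite Q"
    by (rule obtain_subset_with_card_n)
  let ?A = "insert x S \<union> Q"
  have "card ?A = card (insert x S) + card Q" using Q finS S by (intro card_Un_disjoint) auto
  also have "x \<notin> S" using x S by auto
  then have "card (insert x S) = t + 1" using S finS by simp
  finally have "card ?A = k" using Q k_ge by simp
  moreover have "?A \<subseteq> V" using Q S W x by auto
  ultimately have "?A \<in> nsets V k" using Q finS by (simp add: nsets_def)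
  moreover have "?A \<inter> insert x W = insert x S" using Q S by blast
  ultimately have "?A \<in> trace W S" using star by blast
  then have "?A \<in> \<F>" by (simp add: trace_def)
  then have "t \<le> card (?A \<inter> F)" using F by (rule card_inter)
  also have "?A \<inter> F = S \<inter> F" using Q xF by blast
  also have "card (S \<inter> F) < t" using psubset_card_mono[OF finS ST] S by simp
  finally show False by simp
qed

text \<open>A trace of more than \<open>t\<close> elements would be all of \<open>W\<close> and
  contain \<open>S\<close>. So only the \<open>t\<close> other \<open>t\<close>-subsets of
  \<open>W\<close> occur, each bounded by a star, and equality in the total forces equality for
  each.\<close>

lemma card_not_superset_le_near:
  assumes W: "W \<subseteq> V" "card W = t + 1" "\<forall>F \<in> \<F>. t \<le> card (F \<inter> W)"
    and nc: "no_cover_below (t + 1)"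
  obtains S where "S \<in> nsets V t" "card {F \<in> \<F>. \<not> S \<subseteq> F} \<le> t * star_size"
    "card {F \<in> \<F>. \<not> S \<subseteq> F} = t * star_size \<Longrightarrow>
      \<exists>Z \<in> nsets V (t + 2). \<forall>F \<in> \<F>. t + 1 \<le> card (F \<inter> Z)"
proof -
  have finW: "finite W" using W finite_ground finite_subset by blast
  have finN: "finite (nsets W t)" using finW by (rule finite_imp_finite_nsets)
  have fint: "finite (trace W T)" for T using finite_family by (simp add: trace_def)
  obtain S where S: "S \<in> nsets W t"
    "\<And>T. T \<in> nsets W t \<Longrightarrow> card (trace W T) \<le> card (trace W S)"
    using popular_subset_exists[of W t "\<lambda>T. card (trace W T)"] finW W(2) by auto
  have SW: "S \<subseteq> W" "card S = t" using S(1) by (auto simp: nsets_def)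
  let ?N = "nsets W t - {S}"
  have "card ?N = t" using S(1) finN finW W(2) by (simp add: card_nsets_eq)
  have "{F \<in> \<F>. \<not> S \<subseteq> F} \<subseteq> (\<Union>T \<in> ?N. trace W T)"
  proof
    fix F assume F: "F \<in> {F \<in> \<F>. \<not> S \<subseteq> F}"
    have "card (F \<inter> W) = t"
    proof (rule ccontr)
      assume "card (F \<inter> W) \<noteq> t"
      moreover have "t \<le> card (F \<inter> W)" using F W(3) by blast
      ultimately have "card W \<le> card (F \<inter> W)" using W(2) by simp
      then have "F \<inter> W = W" using finW by (intro card_seteq) auto
      then show False using F SW by blast
    qed
    then have "F \<inter> W \<in> ?N" using F finW by (auto simp: nsets_def)
    then show "F \<in> (\<Union>T \<in> ?N. trace W T)"
      using F by (intro UN_I[of "F \<inter> W"]) (auto simp: trace_def)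
  qed
  then have "card {F \<in> \<F>. \<not> S \<subseteq> F} \<le> card (\<Union>T \<in> ?N. trace W T)"
    using finN fint by (intro card_mono) auto
  also have "\<dots> \<le> (\<Sum>T \<in> ?N. card (trace W T))" using finN by (intro card_UN_le) auto
  finally have le: "card {F \<in> \<F>. \<not> S \<subseteq> F} \<le> (\<Sum>T \<in> ?N. card (trace W T))" .
  have each: "card (trace W T) \<le> star_size" if "T \<in> ?N" for T
    using that S by (intro card_smaller_trace_le_star_size(1)[OF W(1,2) S(1) _ _ _ nc]) auto
  have sum: "(\<Sum>T \<in> ?N. star_size) = t * star_size" using \<open>card ?N = t\<close> by simp
  show ?thesis
  proof (rule that[of S])
    show "S \<in> nsets V t" using S(1) W(1) nsets_mono by blast
    have "(\<Sum>T \<in> ?N. card (trace W T)) \<le> (\<Sum>T \<in> ?N. star_size)" by (intro sum_mono each)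
    then show "card {F \<in> \<F>. \<not> S \<subseteq> F} \<le> t * star_size" using le sum by linarith
    assume eq: "card {F \<in> \<F>. \<not> S \<subseteq> F} = t * star_size"
    have "?N \<noteq> {}" using \<open>card ?N = t\<close> t_ge by (metis card.empty not_numeral_le_zero)
    then obtain T where T: "T \<in> ?N" by blast
    then have T': "T \<in> nsets W t" "T \<noteq> S" by auto
    have "card (trace W T) = star_size"
    proof (rule ccontr)
      assume "card (trace W T) \<noteq> star_size"
      then have "card (trace W T) < star_size" using each[OF T] by simp
      then have "(\<Sum>T \<in> ?N. card (trace W T)) < (\<Sum>T \<in> ?N. star_size)"
        using finN T each by (intro sum_strict_mono_ex1) auto
      then show False using le eq sum by linarith
    qed
    then have "\<exists>x \<in> V - W. trace W S = {F \<in> nsets V k. F \<inter> insert x W = insert x S}"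
      by (rule card_smaller_trace_le_star_size(2)[OF W(1,2) S(1) T' S(2)[OF T'(1)] nc])
    then obtain x where x: "x \<in> V - W"
      "trace W S = {F \<in> nsets V k. F \<inter> insert x W = insert x S}" by (rule bexE)
    have "insert x W \<in> nsets V (t + 2)" using x W finW by (auto simp: nsets_def)
    then show "\<exists>Z \<in> nsets V (t + 2). \<forall>F \<in> \<F>. t + 1 \<le> card (F \<inter> Z)"
      using near_star_contained[OF W SW x] by blast
  qed
qed

section \<open>Combination of all sizes of a smallest cover\<close>

lemma sparse_t_set_exists:
  obtains S where "S \<in> nsets V t" "card {F \<in> \<F>. \<not> S \<subseteq> F} \<le> t * star_size"
    "card {F \<in> \<F>. \<not> S \<subseteq> F} = t * star_size \<Longrightarrow>
      \<exists>Z \<in> nsets V (t + 2). \<forall>F \<in> \<F>. t + 1 \<le> card (F \<inter> Z)"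
proof (cases "\<F> = {}")
  \<comment> \<open>The empty family is separate because its smallest cover has fewer than
    \<open>t\<close> elements. Any \<open>t\<close>-set works, and equality is impossible since
    \<open>t * star_size\<close> is positive.\<close>
  case True
  have "nsets V t \<noteq> {}" using ground_ge by (simp add: nsets_eq_empty_iff)
  then obtain S where "S \<in> nsets V t" by blast
  moreover have "0 < t * star_size" using star_size_pos t_ge by simp
  ultimately show ?thesis using True by (intro that[of S]) auto
next
  case False
  have "t \<le> card (F \<inter> V)" if "F \<in> \<F>" for F
    using memD[OF that] k_ge by (simp add: Int_absorb2)
  then obtain C where C: "C \<subseteq> V" "\<forall>F \<in> \<F>. t \<le> card (F \<inter> C)"
    "\<forall>D \<subseteq> V. card D < card C \<longrightarrow> (\<exists>F \<in> \<F>. card (F \<inter> D) < t)"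
    using min_cover_exists[of V V \<F> t] by (metis subset_refl)
  have nc: "no_cover_below (card C)" using C(3) by (simp add: no_cover_below_def)
  have finC: "finite C" using C finite_ground finite_subset by blast
  obtain F where "F \<in> \<F>" using False by blast
  then have "t \<le> card C" using C(2) finC by (meson card_mono inf_le2 le_trans)
  then obtain s where s: "card C = t + s" using le_Suc_ex by blast
  have pos: "0 < t * star_size" using star_size_pos t_ge by simp
  consider "s = 0" | "s = 1" | "2 \<le> s" by linarith
  then show ?thesis
  proof cases
    case 1
    have "C \<subseteq> F" if "F \<in> \<F>" for F
    proof -
      have "card C \<le> card (F \<inter> C)" using C(2) that s 1 by simp
      then have "F \<inter> C = C" using finC by (intro card_seteq) auto
      then show ?thesis by blast
    qed
    then have none: "{F \<in> \<F>. \<not> C \<subseteq> F} = {}" by blast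
    have "C \<in> nsets V t" using C(1) finC s 1 by (simp add: nsets_def)
    then show ?thesis using pos by (intro that[of C]) (simp_all add: none)
  next
    case 2
    show ?thesis
      by (rule card_not_superset_le_near[of C]) (use C s 2 nc that in auto)
  next
    case 3
    obtain S where S: "S \<in> nsets V t" "card {F \<in> \<F>. \<not> S \<subseteq> F} \<le> 197/200 * t * mu"
      by (rule card_not_superset_le_weight[OF C(1) s C(2) 3 nc[unfolded s]])
    \<comment> \<open>The gap between 197/200 and 71/72 makes the bound strict, so equality cannot
      occur.\<close>
    have "t * (197/200 * mu) < t * (71/72 * mu)"
      using mu_pos t_ge by (intro mult_strict_left_mono) auto
    also have "\<dots> \<le> t * real star_size" using star_size_ge by (intro mult_left_mono) auto
    finally have "real (card {F \<in> \<F>. \<not> S \<subseteq> F}) < real (t * star_size)" using S(2) by simp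
    then have "card {F \<in> \<F>. \<not> S \<subseteq> F} < t * star_size" by (simp only: of_nat_less_iff)
    then show ?thesis using S(1) by (intro that[of S]) auto
  qed
qed

end

section \<open>Diversity\<close>

text \<open>With the next lemma, this treats the diversity as the least number of members not
  containing \<open>S\<close>, over all \<open>t\<close>-sets \<open>S\<close>.\<close>

lemma t_diversity_le:
  assumes S: "S \<in> nsets {1..n} t" and fin: "finite \<F>"
  shows "t_diversity n t \<F> \<le> card {F \<in> \<F>. \<not> S \<subseteq> F}"
proof -
  have "card {F \<in> \<F>. S \<subseteq> F} \<le> max_t_degree n t \<F>"
    unfolding max_t_degree_def using S by (intro Max_ge) (auto simp: finite_imp_finite_nsets)
  moreover have "card \<F> = card {F \<in> \<F>. S \<subseteq> F} + card {F \<in> \<F>. \<not> S \<subseteq> F}"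
    using fin by (subst card_Un_disjoint[symmetric]) (auto intro: arg_cong[of _ _ card])
  ultimately show ?thesis by (simp add: t_diversity_def)
qed

lemma t_diversity_ge:
  assumes "t \<le> n" and fin: "finite \<F>"
    and each: "\<And>S. S \<in> nsets {1..n} t \<Longrightarrow> c \<le> card {F \<in> \<F>. \<not> S \<subseteq> F}"
  shows "c \<le> t_diversity n t \<F>"
proof -
  let ?deg = "\<lambda>S. card {F \<in> \<F>. S \<subseteq> F}"
  have "nsets {1..n} t \<noteq> {}" using assms(1) by (simp add: nsets_eq_empty_iff)
  then have "Max (?deg ` nsets {1..n} t) \<in> ?deg ` nsets {1..n} t"
    by (intro Max_in) (auto simp: finite_imp_finite_nsets)
  then obtain S where S: "Max (?deg ` nsets {1..n} t) = ?deg S" "S \<in> nsets {1..n} t"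
    by (rule imageE)
  then have "max_t_degree n t \<F> = ?deg S" by (simp add: max_t_degree_def)
  moreover have "card \<F> = card {F \<in> \<F>. S \<subseteq> F} + card {F \<in> \<F>. \<not> S \<subseteq> F}"
    using fin by (subst card_Un_disjoint[symmetric]) (auto intro: arg_cong[of _ _ card])
  ultimately show ?thesis using each[OF S(2)] by (simp add: t_diversity_def)
qed

text \<open>For a \<^term>\<open>t\<close>-set \<^term>\<open>S\<close> it suffices to count the members of the Frankl family
  that miss exactly one element of \<^term>\<open>Z\<close>; if \<^term>\<open>S\<close> has an element \<^term>\<open>x\<close> outside
  \<^term>\<open>Z\<close>, those avoiding \<^term>\<open>x\<close> are counted as well.\<close>

lemma t_diversity_frankl_family_ge:
  assumes Z: "Z \<subseteq> {1..n}" "card Z = t + 2" and k: "t + 2 \<le> k" and n: "k + 1 < n"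
    and wide: "(t + 2) * (k - t - 1) \<le> 2 * (n - t - 2)"
  shows "t * ((n - (t + 2)) choose (k - (t + 1))) \<le> t_diversity n t (frankl_family n k t Z)"
proof (rule t_diversity_ge)
  let ?A = "frankl_family n k t Z"
  show "t \<le> n" using n k by simp
  show finA: "finite ?A" by (simp add: frankl_family_def finite_imp_finite_nsets)
  have finZ: "finite Z" using Z finite_subset by blast
  define N where "N = (n - (t + 2)) choose (k - (t + 1))"
  define N' where "N' = (n - (t + 3)) choose (k - (t + 1))"
  have inA: "F \<in> ?A" if "F \<in> nsets {1..n} k" "F \<inter> Z = Z - {z}" "z \<in> Z" for F z
    using that Z finZ by (simp add: frankl_family_def)
  fix S assume S: "S \<in> nsets {1..n} t"
  have Sb: "S \<subseteq> {1..n}" "card S = t" "finite S" using S by (auto simp: nsets_def)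
  let ?P = "\<lambda>z. {F \<in> nsets {1..n} k. F \<inter> Z = Z - {z}}"
  have cardP: "card (?P z) = N" if "z \<in> Z" for z
    using card_nsets_trace[of "{1..n}" Z "Z - {z}" k] that Z k finZ by (simp add: N_def)
  show "t * ((n - (t + 2)) choose (k - (t + 1))) \<le> card {F \<in> ?A. \<not> S \<subseteq> F}"
  proof (cases "S \<subseteq> Z")
    case True
    have "t * N = (\<Sum>z \<in> S. card (?P z))" using True cardP Sb by (simp add: subset_iff)
    also have "\<dots> = card (\<Union>z \<in> S. ?P z)"
      using Sb True by (intro card_UN_disjoint[symmetric]) (auto simp: finite_imp_finite_nsets)
    also have "\<dots> \<le> card {F \<in> ?A. \<not> S \<subseteq> F}"
      using finA True inA by (intro card_mono) (simp, blast)
    finally show ?thesis by (simp add: N_def)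
  next
    case False
    then obtain x where x: "x \<in> S" "x \<notin> Z" by blast
    have xn: "x \<in> {1..n}" using x Sb by blast
    let ?Q = "\<lambda>z. if z \<in> S then ?P z
      else {F \<in> nsets {1..n} k. F \<inter> insert x Z = Z - {z}}"
    have cardQ: "card (?Q z) = (if z \<in> S then N else N')" if z: "z \<in> Z" for z
    proof -
      have "card (insert x Z) = t + 3" "card (Z - {z}) = t + 1" using x finZ Z z by auto
      then have "card {F \<in> nsets {1..n} k. F \<inter> insert x Z = Z - {z}} = N'"
        using card_nsets_trace[of "{1..n}" "insert x Z" "Z - {z}" k] Z(1) xn k
        by (simp add: N'_def subset_insertI2)
      then show ?thesis using cardP[OF z] by simp
    qed
    define i where "i = card (Z \<inter> S)"
    have "Z \<inter> S \<subset> S" using x by blast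
    then have "i < t" using psubset_card_mono[OF Sb(3)] Sb(2) by (simp add: i_def)
    have "N' \<le> N" unfolding N_def N'_def by (intro binomial_right_mono) simp
    \<comment> \<open>Avoiding \<open>x\<close> as well shrinks \<open>N\<close> to
      \<open>N' = N * (a - b) / a\<close>. Since \<open>wide\<close> says
      \<open>b / a \<le> 2 / (t + 2)\<close>, the \<open>t + 2\<close> classes suffice even if
      \<open>S\<close> is disjoint from \<open>Z\<close>.\<close>
    have "t * N \<le> (t + 2) * N'"
    proof -
      define a b where "a = n - (t + 2)" and "b = k - (t + 1)"
      have ab: "0 < a" "b < a" "n - (t + 3) = a - 1" using n k by (auto simp: a_def b_def)
      have "(t + 2) * b \<le> 2 * a" using wide by (simp add: a_def b_def)
      then have "t * a \<le> (t + 2) * (a - b)" 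
        unfolding diff_mult_distrib2 add_mult_distrib by linarith
      then have "t * a * (a choose b) \<le> (t + 2) * (a - b) * (a choose b)" by (rule mult_le_mono1)
      also have "\<dots> = (t + 2) * (a * ((a - 1) choose b))"
        by (simp only: mult.assoc binomial_absorb_comp)
      finally have "a * (t * (a choose b)) \<le> a * ((t + 2) * ((a - 1) choose b))"
        by (simp only: mult_ac)
      then show ?thesis using ab by (simp add: N_def N'_def a_def b_def)
    qed
    moreover have "i * N' \<le> i * N" using \<open>N' \<le> N\<close> by simp
    moreover have "(t + 2 - i) * N' + i * N' = (t + 2) * N'"
      using \<open>i < t\<close> by (simp flip: distrib_right)
    ultimately have "t * N \<le> i * N + (t + 2 - i) * N'" by linarith
    also have "\<dots> = (\<Sum>z \<in> Z. card (?Q z))"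
    proof -
      have "(\<Sum>z \<in> Z. card (?Q z)) = (\<Sum>z \<in> Z. if z \<in> S then N else N')"
        using cardQ by (intro sum.cong) auto
      also have "\<dots> = i * N + card (Z - S) * N'"
        using finZ by (simp add: sum.If_cases i_def Diff_eq)
      also have "card (Z - S) = t + 2 - i"
        using finZ Z card_Diff_subset_Int[of Z S] by (simp add: i_def)
      finally show ?thesis by simp
    qed
    also have "\<dots> = card (\<Union>z \<in> Z. ?Q z)"
    proof (rule card_UN_disjoint[symmetric, OF finZ])
      show "\<forall>z \<in> Z. finite (?Q z)" by (simp add: finite_imp_finite_nsets)
      have Q: "F \<inter> Z = Z - {z}" if "F \<in> ?Q z" for F z using that x by (auto split: if_splits)
      show "\<forall>z \<in> Z. \<forall>w \<in> Z. z \<noteq> w \<longrightarrow> ?Q z \<inter> ?Q w = {}"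
        using Q by blast
    qed
    also have "\<dots> \<le> card {F \<in> ?A. \<not> S \<subseteq> F}"
    proof (intro card_mono subsetI)
      fix F assume "F \<in> (\<Union>z \<in> Z. ?Q z)"
      then obtain z where z: "z \<in> Z" "F \<in> ?Q z" by blast
      then have "F \<in> nsets {1..n} k" "F \<inter> Z = Z - {z}" using x by (auto split: if_splits)
      moreover have "\<not> S \<subseteq> F" using z x by (auto split: if_splits)
      ultimately show "F \<in> {F \<in> ?A. \<not> S \<subseteq> F}" using inA z by blast
    qed (use finA in simp)
    finally show ?thesis by (simp add: N_def)
  qed
qed

section \<open>Numerical bound for e, and the diversity inequality\<close>

lemma exp_1_ge: "21/8 \<le> exp (1::real)"
proof -
  \<comment> \<open>13/8 is \<open>1 + x + x ^ 2 / 2\<close> at \<open>x = 1/2\<close>, and its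
    square 169/64 exceeds 21/8.\<close>
  have "13/8 \<le> exp (1/2::real)"
    using exp_lower_Taylor_quadratic[of "1/2"] by (simp add: power2_eq_square)
  then have "(13/8) ^ 2 \<le> exp (1/2::real) ^ 2" by (intro power_mono) auto
  also have "\<dots> = exp 1" by (simp flip: exp_of_nat_mult)
  finally show ?thesis by (simp add: power2_eq_square)
qed

theorem corollary1p11:
  fixes n k t :: nat and \<F> :: "nat set set"
  assumes "k \<ge> t + 2" and "t + 2 \<ge> 4"
    and "real n \<ge> real t + (real k - real t) * max (18 * (real t + 2)) (2 * exp 1 * real k)"
    and "\<F> \<subseteq> nsets {1..n} k"
    and "t_intersecting t \<F>"
  shows "t_diversity n t \<F> \<le> t_diversity n t (frankl_family n k t {1..t + 2})
    \<and> (t_diversity n t \<F> = t_diversity n t (frankl_family n k t {1..t + 2})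
        \<longrightarrow> (\<exists>Z \<in> nsets {1..n} (t + 2). \<F> \<subseteq> frankl_family n k t Z))"
proof -
  have kt: "real (k - t) = real k - real t" using assms(1) by simp
  have prod: "(real k - real t) * y \<le> real n - real t"
    if "y \<le> max (18 * (real t + 2)) (2 * exp 1 * real k)" for y
  proof -
    have "(real k - real t) * y \<le> (real k - real t) * max (18 * (real t + 2)) (2 * exp 1 * real k)"
      using that assms(1) by (intro mult_left_mono) auto
    then show ?thesis using assms(3) by linarith
  qed
  have "0 \<le> (real k - real t) * (18 * (real t + 2))" using assms(1) by simp
  then have tn: "t \<le> n" using prod[of "18 * (real t + 2)"] by simp
  interpret wide_t_intersecting_family "{1..n}" k t \<F>
  proof
    show "real (k - t) * (18 * (real t + 2)) \<le> real (card {1..n} - t)"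
      using prod[of "18 * (real t + 2)"] kt tn by simp
    have "21/4 * real k \<le> 2 * exp 1 * real k"
      using exp_1_ge by (intro mult_right_mono) auto
    then have "21/4 * real k \<le> max (18 * (real t + 2)) (2 * exp 1 * real k)"
      by (rule max.coboundedI2)
    then have "(real k - real t) * (21/4 * real k) \<le> real n - real t" by (rule prod)
    then show "real (k - t) * (21/4 * real k) \<le> real (card {1..n} - t)"
      using kt tn by simp
  qed (use assms in auto)
  have fin: "finite \<F>" by (rule finite_family)
  obtain S where S: "S \<in> nsets {1..n} t" "card {F \<in> \<F>. \<not> S \<subseteq> F} \<le> t * star_size"
    "card {F \<in> \<F>. \<not> S \<subseteq> F} = t * star_size \<Longrightarrow>
      \<exists>Z \<in> nsets {1..n} (t + 2). \<forall>F \<in> \<F>. t + 1 \<le> card (F \<inter> Z)"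
    using sparse_t_set_exists by blast
  have upper: "t_diversity n t \<F> \<le> card {F \<in> \<F>. \<not> S \<subseteq> F}"
    by (rule t_diversity_le[OF S(1) fin])
  have lower: "t * star_size \<le> t_diversity n t (frankl_family n k t {1..t + 2})"
  proof -
    \<comment> \<open>The product \<open>(t + 2) * (k - t)\<close> is at least 8 and at least
      \<open>k - t\<close>, and 18 times it is at most \<open>n - t\<close>; this yields all size
      conditions of the lower bound.\<close>
    have "real ((k - t) * (18 * (t + 2))) \<le> real (n - t)"
      using wide_t by (simp add: add.commute)
    then have "18 * ((t + 2) * (k - t)) \<le> n - t" by (simp only: of_nat_le_iff mult_ac)
    moreover have "4 * 2 \<le> (t + 2) * (k - t)" using assms(1,2) by (intro mult_le_mono) auto
    moreover have "(t + 2) * (k - t - 1) \<le> (t + 2) * (k - t)" by (intro mult_le_mono) auto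
    moreover have "1 * (k - t) \<le> (t + 2) * (k - t)" by (intro mult_le_mono1) simp
    ultimately have "k + 1 < n" "(t + 2) * (k - t - 1) \<le> 2 * (n - t - 2)" "t + 2 \<le> n" by linarith+
    then show ?thesis using t_diversity_frankl_family_ge[of "{1..t + 2}" n t k] assms(1) by simp
  qed
  show ?thesis
  proof (intro conjI impI)
    show "t_diversity n t \<F> \<le> t_diversity n t (frankl_family n k t {1..t + 2})"
      using upper lower S(2) by linarith
    assume "t_diversity n t \<F> = t_diversity n t (frankl_family n k t {1..t + 2})"
    \<comment> \<open>Both \<open>upper\<close> and \<open>lower\<close> belong to one chain of
      inequalities through \<open>t * star_size\<close>, which collapses when its ends
      agree.\<close>
    then have "card {F \<in> \<F>. \<not> S \<subseteq> F} = t * star_size" using upper lower S(2) by linarith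
    then obtain Z where "Z \<in> nsets {1..n} (t + 2)" "\<forall>F \<in> \<F>. t + 1 \<le> card (F \<inter> Z)"
      using S(3) by blast
    then show "\<exists>Z \<in> nsets {1..n} (t + 2). \<F> \<subseteq> frankl_family n k t Z"
      using assms(4) by (auto simp: frankl_family_def)
  qed
qed

end
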